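(* The function $\mathrm{Iso}$ defined in the context is monotonic increasing on $[0,\sqrt2-1)$, and $\lim_{z\to\sqrt2-1}\mathrm{Iso}(z)=1$ (limit from the left). In particular, $\mathrm{Iso}:[0,\sqrt2-1)\to\left[\tfrac32(2\pi^2)^{-1/4},\,1\right)$ is a bijection.
   Context: Let $\bar A(z)=4+52z+477z^2+3809z^3+\cdots$ be the unique power series with $\bar A(0)=4$ satisfying $$z(z-1)(z^2-6z+1)(z+1)^2\bar A''(z)+(z+1)(5z^4-8z^3-32z^2+28z-1)\bar A'(z)+(4z^4+11z^3-z^2-43z+13)\bar A(z)=0,$$ and let $\bar V(z)=2+48z+\frac{1269}{2}z^2+6600z^3+\cdots$ be the unique power series with $\bar V(0)=2$ satisfying $$z(z-1)(z+1)(z^2-6z+1)^2\bar V''(z)+(z^2-6z+1)(7z^4-22z^3-18z^2+26z-1)\bar V'(z)+3(3z^5-24z^4-2z^3+56z^2-25z+8)\bar V(z)=0.$$ Both series converge for $|z|<3-2\sqrt2=(\sqrt2-1)^2$. For $|z|<\sqrt2-1$ put $$A(z)=\sqrt2\,\pi^2\,\bar A(z^2),\qquad V(z)=\sqrt2\,\pi^2\,\bar V(z^2).$$ The function $\mathrm{Iso}$ is defined for $z\in[0,\sqrt2-1)$ by $\mathrm{Iso}(z)=6\sqrt\pi\,\dfrac{V(z)}{A(z)^{3/2}}$. *)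

theory Defs
  imports "HOL-Analysis.Analysis"
begin

definition ode_A :: "real fps \<Rightarrow> bool" where
  "ode_A f \<longleftrightarrow>
     fps_X * (fps_X - 1) * (fps_X^2 - 6 * fps_X + 1) * (fps_X + 1)^2 * fps_deriv (fps_deriv f)
     + (fps_X + 1) * (5 * fps_X^4 - 8 * fps_X^3 - 32 * fps_X^2 + 28 * fps_X - 1) * fps_deriv f
     + (4 * fps_X^4 + 11 * fps_X^3 - fps_X^2 - 43 * fps_X + 13) * f = 0"

definition ode_V :: "real fps \<Rightarrow> bool" where
  "ode_V f \<longleftrightarrow>
     fps_X * (fps_X - 1) * (fps_X + 1) * (fps_X^2 - 6 * fps_X + 1)^2 * fps_deriv (fps_deriv f)
     + (fps_X^2 - 6 * fps_X + 1) * (7 * fps_X^4 - 22 * fps_X^3 - 18 * fps_X^2 + 26 * fps_X - 1)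
       * fps_deriv f
     + 3 * (3 * fps_X^5 - 24 * fps_X^4 - 2 * fps_X^3 + 56 * fps_X^2 - 25 * fps_X + 8) * f = 0"

text \<open>The descriptions below are proper: see the lemmas \<open>ex1_A_bar\<close> and \<open>ex1_V_bar\<close>.\<close>

definition A_bar :: "real fps" where
  "A_bar = (THE f. fps_nth f 0 = 4 \<and> ode_A f)"

definition V_bar :: "real fps" where
  "V_bar = (THE f. fps_nth f 0 = 2 \<and> ode_V f)"

text \<open>\<open>eval_fps\<close> is a sum of a series, so the following three functions are meaningful only
  where the series converge (\<open>\<bar>z\<bar> < sqrt 2 - 1\<close>); \<open>Iso\<close> is used on \<open>{0..<sqrt 2 - 1}\<close> only.\<close>

definition A_fun :: "real \<Rightarrow> real" where
  "A_fun z = sqrt 2 * pi^2 * eval_fps A_bar (z^2)"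

definition V_fun :: "real \<Rightarrow> real" where
  "V_fun z = sqrt 2 * pi^2 * eval_fps V_bar (z^2)"

definition Iso :: "real \<Rightarrow> real" where
  "Iso z = 6 * sqrt pi * (V_fun z / A_fun z powr (3/2))"

text \<open>Frobenius at a regular singular point with double exponent \<open>0\<close>: the coefficient of \<open>X^n\<close>
  in the equation determines coefficient \<open>n + 1\<close> of the solution, with leading factor
  \<open>-(n + 1)^2\<close>.\<close>

lemma ode_coeff:
  fixes p q r f :: "real fps"
  assumes p0: "fps_nth p 0 = -1" and q0: "fps_nth q 0 = -1"
  shows "fps_nth (fps_X * p * fps_deriv (fps_deriv f) + q * fps_deriv f + r * f) n =
    (\<Sum>i\<in>{1..<n}. fps_nth p i * (of_nat (n-i) * (of_nat (Suc (n-i)) * fps_nth f (Suc (n-i)))))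
    + (\<Sum>i\<in>{1..n}. fps_nth q i * (of_nat (Suc (n-i)) * fps_nth f (Suc (n-i))))
    + (\<Sum>i\<in>{0..n}. fps_nth r i * fps_nth f (n-i)) - (of_nat (Suc n))^2 * fps_nth f (Suc n)"
proof -
  have P: "fps_nth (fps_X * p * fps_deriv (fps_deriv f)) n =
    (\<Sum>i\<in>{1..<n}. fps_nth p i * (of_nat (n-i) * (of_nat (Suc (n-i)) * fps_nth f (Suc (n-i)))))
    - of_nat n * of_nat (Suc n) * fps_nth f (Suc n)"
  proof (cases n)
    case 0
    then show ?thesis by (simp add: mult.assoc)
  next
    case (Suc m)
    have "fps_nth (fps_X * p * fps_deriv (fps_deriv f)) n =
      (\<Sum>i\<in>{0..m}. fps_nth p i * fps_nth (fps_deriv (fps_deriv f)) (m-i))"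
      by (simp only: Suc mult.assoc fps_X_mult_nth) (simp add: fps_mult_nth del: fps_deriv_nth)
    also have "\<dots> = - fps_nth (fps_deriv (fps_deriv f)) m
      + (\<Sum>i\<in>{1..m}. fps_nth p i * fps_nth (fps_deriv (fps_deriv f)) (m-i))"
      by (simp add: sum.atLeast_Suc_atMost p0 del: fps_deriv_nth)
    also have "(\<Sum>i\<in>{1..m}. fps_nth p i * fps_nth (fps_deriv (fps_deriv f)) (m-i)) =
      (\<Sum>i\<in>{1..<n}. fps_nth p i * (of_nat (n-i) * (of_nat (Suc (n-i)) * fps_nth f (Suc (n-i)))))"
      by (rule sum.cong) (auto simp: Suc Suc_diff_le)
    finally show ?thesis by (simp add: Suc algebra_simps)
  qed
  have Q: "fps_nth (q * fps_deriv f) n =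
    (\<Sum>i\<in>{1..n}. fps_nth q i * (of_nat (Suc (n-i)) * fps_nth f (Suc (n-i))))
    - of_nat (Suc n) * fps_nth f (Suc n)"
    by (simp add: fps_mult_nth sum.atLeast_Suc_atMost q0)
  show ?thesis
    unfolding fps_add_nth P Q fps_mult_nth[of r] of_nat_Suc by (simp add: power2_eq_square distrib_left distrib_right)
qed

lemma ode_ex1:
  fixes p q r :: "real fps" and c :: real
  assumes p0: "fps_nth p 0 = -1" and q0: "fps_nth q 0 = -1"
  shows "\<exists>!f. fps_nth f 0 = c \<and> fps_X * p * fps_deriv (fps_deriv f) + q * fps_deriv f + r * f = 0"
proof -
  define G where "G = (\<lambda>(h :: nat \<Rightarrow> real) n.
    (\<Sum>i\<in>{1..<n}. fps_nth p i * (of_nat (n-i) * (of_nat (Suc (n-i)) * h (Suc (n-i)))))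
    + (\<Sum>i\<in>{1..n}. fps_nth q i * (of_nat (Suc (n-i)) * h (Suc (n-i))))
    + (\<Sum>i\<in>{0..n}. fps_nth r i * h (n-i)))"
  have G_cong: "G g n = G h n" if "\<And>k. k \<le> n \<Longrightarrow> g k = h k" for g h n
    unfolding G_def by (intro arg_cong2[where f="(+)"] sum.cong) (auto simp: that)
  have coeff: "fps_nth (fps_X * p * fps_deriv (fps_deriv f) + q * fps_deriv f + r * f) n =
      G (fps_nth f) n - (of_nat (Suc n))^2 * fps_nth f (Suc n)" for f n
    unfolding G_def by (rule ode_coeff[OF p0 q0])
  have iff: "fps_X * p * fps_deriv (fps_deriv f) + q * fps_deriv f + r * f = 0 \<longleftrightarrow>
      (\<forall>n. fps_nth f (Suc n) = G (fps_nth f) n / (of_nat (Suc n))^2)" for f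
    unfolding fps_eq_iff coeff
    by (simp add: eq_divide_eq eq_commute[of "G _ _"] mult.commute del: of_nat_Suc)
  define F where "F = (\<lambda>(g :: nat \<Rightarrow> real) k. case k of 0 \<Rightarrow> c | Suc n \<Rightarrow> G g n / (of_nat (Suc n))^2)"
  define h where "h = wfrec less_than F"
  have adm: "adm_wf less_than F"
    by (auto simp: adm_wf_def F_def split: nat.split intro!: arg_cong2[where f="(/)"] G_cong)
  have h_rec: "h k = F h k" for k
    unfolding h_def by (subst wfrec_fixpoint[OF wf_less_than adm]) simp
  have nth_h: "fps_nth (Abs_fps h) = h"
    by (rule ext) simp
  show ?thesis
  proof (rule ex1I[of _ "Abs_fps h"])
    show "fps_nth (Abs_fps h) 0 = c \<and> fps_X * p * fps_deriv (fps_deriv (Abs_fps h))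
        + q * fps_deriv (Abs_fps h) + r * Abs_fps h = 0"
      unfolding iff nth_h using h_rec[of 0] h_rec[of "Suc _"] by (auto simp: F_def)
  next
    fix f
    assume f: "fps_nth f 0 = c \<and> fps_X * p * fps_deriv (fps_deriv f) + q * fps_deriv f + r * f = 0"
    have "fps_nth f k = h k" for k
    proof (induction k rule: less_induct)
      case (less k)
      show ?case
      proof (cases k)
        case 0
        then show ?thesis using f h_rec[of 0] by (simp add: F_def)
      next
        case (Suc n)
        have "G (fps_nth f) n = G h n" by (rule G_cong) (simp add: less Suc)
        then show ?thesis using f h_rec[of k] unfolding iff by (simp add: F_def Suc)
      qed
    qed
    then show "f = Abs_fps h" by (simp add: fps_eq_iff)
  qed
qed

lemma ex1_A_bar: "\<exists>!f. fps_nth f 0 = 4 \<and> ode_A f"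
  unfolding ode_A_def
  using ode_ex1[of "(fps_X - 1) * (fps_X^2 - 6 * fps_X + 1) * (fps_X + 1)^2"
      "(fps_X + 1) * (5 * fps_X^4 - 8 * fps_X^3 - 32 * fps_X^2 + 28 * fps_X - 1)" 4
      "4 * fps_X^4 + 11 * fps_X^3 - fps_X^2 - 43 * fps_X + 13"]
  by (simp add: mult.assoc fps_power_zeroth)

lemma ex1_V_bar: "\<exists>!f. fps_nth f 0 = 2 \<and> ode_V f"
  unfolding ode_V_def
  using ode_ex1[of "(fps_X - 1) * (fps_X + 1) * (fps_X^2 - 6 * fps_X + 1)^2"
      "(fps_X^2 - 6 * fps_X + 1) * (7 * fps_X^4 - 22 * fps_X^3 - 18 * fps_X^2 + 26 * fps_X - 1)" 2
      "3 * (3 * fps_X^5 - 24 * fps_X^4 - 2 * fps_X^3 + 56 * fps_X^2 - 25 * fps_X + 8)"]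
  by (simp add: mult.assoc fps_power_zeroth)

end

theory Submission
  imports Defs
begin

text \<open>
  With \<open>w = z\<^sup>2\<close>, \<open>u = 4w / (1-w)\<^sup>2\<close>, \<open>F\<^sub>1 = \<^sub>2F\<^sub>1(-1/2,-1/2;1;u)\<close> and
  \<open>F\<^sub>2 = \<^sub>2F\<^sub>1(-3/2,-3/2;1;u)\<close>, comparing differential equations shows that the two series have
  the sums \<open>4 (1-w\<^sup>2) F\<^sub>1 / (w\<^sup>2-6w+1)\<^sup>2\<close> and \<open>2 (1-w)\<^sup>3 F\<^sub>2 / (w\<^sup>2-6w+1)\<^sup>3\<close> at \<open>w\<close>,
  so that \<open>Iso\<close> is a constant times \<open>F\<^sub>2 / ((1+u)\<^bsup>3/4\<^esup> F\<^sub>1\<^bsup>3/2\<^esup>)\<close>.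
  The hypergeometric equations give \<open>F\<^sub>1/4 - F\<^sub>1' = u(1-u) F\<^sub>1'' \<ge> 0\<close> and
  \<open>(1+u) F\<^sub>2' - 3/8 (3+u) F\<^sub>2 = (1-u)/6 ((3+2u) F\<^sub>2' - (3+u) u F\<^sub>2'') > 0\<close>, whence the logarithmic
  derivative is positive. The values at \<open>u = 1\<close> come from Gauss's summation theorem.
\<close>

section \<open>Gauss's summation theorem\<close>

definition gauss_coeff :: "real \<Rightarrow> real \<Rightarrow> real \<Rightarrow> nat \<Rightarrow> real" where
  "gauss_coeff a b c n = pochhammer a n * pochhammer b n / (pochhammer c n * fact n)"

lemma gauss_coeff_0 [simp]: "gauss_coeff a b c 0 = 1"
  by (simp add: gauss_coeff_def)

lemma gauss_coeff_Suc:
  "gauss_coeff a b c (Suc n) = gauss_coeff a b c n * ((a + n) * (b + n) / ((c + n) * (1 + n)))"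
  by (simp add: gauss_coeff_def pochhammer_rec' mult_ac)

lemma gauss_coeff_plus1:
  assumes "c > 0"
  shows "gauss_coeff a b (c + 1) n = gauss_coeff a b c n * (c / (c + n))"
proof -
  have "pochhammer (c + 1) n * c = pochhammer c n * (c + n)"
    using pochhammer_rec[of c n] pochhammer_rec'[of c n] by (simp add: mult_ac)
  then have "pochhammer (c + 1) n = pochhammer c n * ((c + n) / c)"
    using assms by (simp add: field_simps)
  then show ?thesis
    unfolding gauss_coeff_def by (simp add: mult_ac)
qed

text \<open>The two sides differ termwise by \<open>c\<close> times the increment of \<open>n * gauss_coeff a b c n\<close>.\<close>

lemma gauss_summation_step:
  assumes c: "c > 0" and sum: "summable (gauss_coeff a b c)"
    and sum': "summable (gauss_coeff a b (c + 1))"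
    and lim: "(\<lambda>n. n * gauss_coeff a b c n) \<longlonglongrightarrow> 0"
  shows "c * (c - a - b) * suminf (gauss_coeff a b c)
    = (c - a) * (c - b) * suminf (gauss_coeff a b (c + 1))"
proof -
  define t where "t = gauss_coeff a b c"
  have tele: "(\<lambda>n. real (Suc n) * t (Suc n) - real n * t n) sums (0 - real 0 * t 0)"
    using lim unfolding t_def by (rule telescope_sums)
  have eq: "(c - a) * (c - b) * gauss_coeff a b (c + 1) n =
      c * (c - a - b) * t n + c * (real (Suc n) * t (Suc n) - real n * t n)" for n
  proof -
    have nz: "c + n \<noteq> 0" using c by (simp add: add_pos_nonneg)
    have step: "real (Suc n) * t (Suc n) = t n * ((a + n) * (b + n) / (c + n))"
      by (simp add: t_def gauss_coeff_Suc add.commute)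
    show ?thesis
      unfolding gauss_coeff_plus1[OF c] t_def[symmetric] step using nz
      by (simp add: divide_simps) (simp add: algebra_simps)
  qed
  have s: "(\<lambda>n. (c - a) * (c - b) * gauss_coeff a b (c + 1) n)
      sums (c * (c - a - b) * suminf t)"
    unfolding eq using sums_add[OF sums_mult[OF summable_sums[OF sum[folded t_def]], of "c * (c - a - b)"]
        sums_mult[OF tele, of c]] by simp
  show "c * (c - a - b) * suminf (gauss_coeff a b c)
    = (c - a) * (c - b) * suminf (gauss_coeff a b (c + 1))"
    using s sums_mult[OF summable_sums[OF sum'], of "(c - a) * (c - b)"] unfolding t_def
    by (metis sums_unique2)
qed

text \<open>For \<open>n > 0\<close> the passage from \<open>M\<close> to \<open>M + 1\<close>
  contributes the factor \<open>(c + M) / (c + M + n)\<close>, which is at most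
  \<open>(c + M) / (c + M + 1)\<close>, and these bounds telescope. The decay in \<open>M\<close> is
  uniform in \<open>n\<close>; index 0 is excluded because the coefficient there is always
  1.\<close>

lemma gauss_coeff_shift_bound:
  assumes c: "c > 0"
  shows "n > 0 \<Longrightarrow> \<bar>gauss_coeff a b (c + real M) n\<bar> \<le> \<bar>gauss_coeff a b c n\<bar> * (c / (c + real M))"
proof (induction M)
  case (Suc M)
  have cM: "c + M > 0" using c by simp
  have SM: "c + real (Suc M) = c + real M + 1" by simp
  have "\<bar>gauss_coeff a b (c + real (Suc M)) n\<bar> = \<bar>gauss_coeff a b (c + real M) n\<bar> * ((c + M) / (c + M + n))"
    unfolding SM gauss_coeff_plus1[OF cM] using cM by (simp add: abs_mult)
  also have "\<dots> \<le> \<bar>gauss_coeff a b c n\<bar> * (c / (c + real M)) * ((c + M) / (c + M + 1))"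
    using Suc cM c by (intro mult_mono divide_left_mono) auto
  also have "\<dots> = \<bar>gauss_coeff a b c n\<bar> * (c / (c + real (Suc M)))"
    unfolding SM using cM by simp
  finally show ?case .
qed (use c in simp)

text \<open>Iterating the passage from \<open>c\<close> to \<open>c + 1\<close> writes the sum as
  \<open>R M * S M\<close>. As \<open>M\<close> grows, \<open>S M\<close> tends to 1, while
  \<open>R M\<close> is a quotient of the sequences in the product formula for the Gamma
  function.\<close>

theorem gauss_summation:
  assumes c: "c > 0" "c - a > 0" "c - b > 0" "c - a - b > 0"
    and sum: "summable (\<lambda>n. \<bar>gauss_coeff a b c n\<bar>)"
    and lim: "(\<lambda>n. n * gauss_coeff a b c n) \<longlonglongrightarrow> 0"
  shows "suminf (gauss_coeff a b c) = Gamma c * Gamma (c - a - b) / (Gamma (c - a) * Gamma (c - b))"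
proof -
  define S where "S M = suminf (gauss_coeff a b (c + real M))" for M :: nat
  have bd: "\<bar>gauss_coeff a b (c + real M) n\<bar> \<le> \<bar>gauss_coeff a b c n\<bar>" for M n
  proof (cases "n = 0")
    case False
    have "\<bar>gauss_coeff a b c n\<bar> * (c / (c + real M)) \<le> \<bar>gauss_coeff a b c n\<bar> * 1"
      using c by (intro mult_left_mono) (auto simp: divide_le_eq)
    then show ?thesis using gauss_coeff_shift_bound[OF c(1), of n a b M] False by linarith
  qed simp
  have summ: "summable (\<lambda>n. \<bar>gauss_coeff a b (c + real M) n\<bar>)" for M
    by (rule summable_comparison_test'[OF sum, of 0]) (use bd in auto)
  have limm: "(\<lambda>n. n * gauss_coeff a b (c + real M) n) \<longlonglongrightarrow> 0" for M
  proof (rule Lim_null_comparison)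
    show "\<forall>\<^sub>F n in sequentially. norm (n * gauss_coeff a b (c + real M) n) \<le> \<bar>n * gauss_coeff a b c n\<bar>"
      using bd[of M] by (intro always_eventually) (auto simp: abs_mult intro: mult_left_mono)
    show "(\<lambda>n. \<bar>real n * gauss_coeff a b c n\<bar>) \<longlonglongrightarrow> 0"
      using lim by (rule tendsto_rabs_zero)
  qed
  define R where "R M = pochhammer (c - a) M * pochhammer (c - b) M
      / (pochhammer c M * pochhammer (c - a - b) M)" for M
  have pos: "pochhammer c M > 0" "pochhammer (c - a) M > 0" "pochhammer (c - b) M > 0"
    "pochhammer (c - a - b) M > 0" for M
    using c by (auto intro: pochhammer_pos)
  have SR: "S 0 = R M * S M" for M
  proof (induction M)
    case 0 then show ?case by (simp add: R_def)
  next
    case (Suc M)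
    have cM: "c + M > 0" "c + M - a - b > 0" using c by auto
    have S_simp: "c + real (Suc M) = c + real M + 1" by simp
    have nz: "(c + M) * (c + M - a - b) \<noteq> 0" using cM by simp
    have "(c + M) * (c + M - a - b) * S M = (c + M - a) * (c + M - b) * S (Suc M)"
      using gauss_summation_step[OF cM(1) summable_rabs_cancel[OF summ]
          summable_rabs_cancel[OF summ[of "Suc M", unfolded S_simp]] limm] cM
      unfolding S_def S_simp by simp
    then have "S M = (c + M - a) * (c + M - b) / ((c + M) * (c + M - a - b)) * S (Suc M)"
      using nz by (metis nonzero_mult_div_cancel_left times_divide_eq_left)
    moreover have "c - a + M = c + M - a" "c - b + M = c + M - b" "c - a - b + M = c + M - a - b"
      by simp_all
    then have "R (Suc M) = R M * ((c + M - a) * (c + M - b) / ((c + M) * (c + M - a - b)))"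
      unfolding R_def pochhammer_rec' by (simp only: times_divide_times_eq mult_ac)
    ultimately show ?case using Suc.IH by simp
  qed
  \<comment> \<open>Only the term of index 0 survives in the limit: the other terms sum to at most
    \<open>K * (c / (c + M))\<close> in absolute value.\<close>
  have S1: "S \<longlonglongrightarrow> 1"
  proof -
    have sum_Suc: "summable (\<lambda>n. \<bar>gauss_coeff a b c (Suc n)\<bar>)"
      using sum summable_Suc_iff[of "\<lambda>n. \<bar>gauss_coeff a b c n\<bar>"] by simp
    define K where "K = (\<Sum>n. \<bar>gauss_coeff a b c (Suc n)\<bar>)"
    have "norm (S M - 1) \<le> K * (c / (c + real M))" for M
    proof -
      have s: "summable (\<lambda>n. \<bar>gauss_coeff a b c (Suc n)\<bar> * (c / (c + real M)))"
        by (intro summable_mult2 sum_Suc)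
      have "S M - 1 = (\<Sum>n. gauss_coeff a b (c + real M) (Suc n))"
        unfolding S_def using suminf_split_head[OF summable_rabs_cancel[OF summ[of M]]] by simp
      also have "norm \<dots> \<le> (\<Sum>n. \<bar>gauss_coeff a b c (Suc n)\<bar> * (c / (c + real M)))"
        using gauss_coeff_shift_bound[OF c(1)] by (intro norm_suminf_le s) auto
      also have "\<dots> = K * (c / (c + real M))"
        unfolding K_def by (intro suminf_mult2[symmetric] sum_Suc)
      finally show ?thesis .
    qed
    then have le: "\<forall>\<^sub>F M in sequentially. norm (S M - 1) \<le> K * (c / (c + real M))"
      by (intro always_eventually allI)
    have "filterlim (\<lambda>M. c + real M) at_top sequentially"
      by (rule filterlim_tendsto_add_at_top[OF tendsto_const filterlim_real_sequentially])
    from tendsto_divide_0[OF tendsto_const filterlim_at_top_imp_at_infinity[OF this], of c]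
    have "(\<lambda>M. K * (c / (c + real M))) \<longlonglongrightarrow> 0"
      by (rule tendsto_mult_right_zero)
    with le have "(\<lambda>M. S M - 1) \<longlonglongrightarrow> 0"
      by (rule Lim_null_comparison)
    then show ?thesis by (simp add: LIM_zero_iff)
  qed
  let ?G = "\<lambda>M. Gamma_series' c M * Gamma_series' (c - a - b) M
      / (Gamma_series' (c - a) M * Gamma_series' (c - b) M)"
  \<comment> \<open>The factorials cancel, and so do the exponentials, because
    \<open>c + (c - a - b) = (c - a) + (c - b)\<close>.\<close>
  have "R M = ?G M" if "M > 0" for M
  proof -
    have "exp (c * ln M) * exp ((c - a - b) * ln M) = exp ((c - a) * ln M) * exp ((c - b) * ln M)"
      by (simp add: exp_add[symmetric] algebra_simps)
    then show ?thesis
      unfolding R_def Gamma_series'_def using pos[of M] that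
      by (simp add: field_simps)
  qed
  then have "\<forall>\<^sub>F M in sequentially. ?G M = R M"
    by (intro eventually_mono[OF eventually_gt_at_top[of 0]]) simp
  moreover have "?G \<longlonglongrightarrow> Gamma c * Gamma (c - a - b) / (Gamma (c - a) * Gamma (c - b))"
    using Gamma_real_pos[OF c(2)] Gamma_real_pos[OF c(3)]
    by (intro tendsto_divide tendsto_mult Gamma_series'_LIMSEQ) simp
  ultimately have "R \<longlonglongrightarrow> Gamma c * Gamma (c - a - b) / (Gamma (c - a) * Gamma (c - b))"
    by (rule Lim_transform_eventually[rotated])
  from tendsto_mult[OF this S1] have "(\<lambda>_. S 0) \<longlonglongrightarrow> Gamma c * Gamma (c - a - b) / (Gamma (c - a) * Gamma (c - b))"
    unfolding SR[symmetric] by simp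
  then show ?thesis by (simp add: S_def LIMSEQ_const_iff)
qed

section \<open>The series with parameters \<open>(a, a; 1)\<close>\<close>

definition gauss_fps :: "real \<Rightarrow> real fps" where
  "gauss_fps a = Abs_fps (gauss_coeff a a 1)"

text \<open>Equal upper parameters and lower parameter 1 make every coefficient a square. The
  nonnegativity obtained from this is behind all later positivity and rearrangement
  arguments.\<close>

lemma gauss_fps_nth: "fps_nth (gauss_fps a) n = (pochhammer a n / fact n)\<^sup>2"
  by (simp add: gauss_fps_def gauss_coeff_def pochhammer_fact[symmetric] power2_eq_square)

lemma gauss_fps_nth_nonneg: "fps_nth (gauss_fps a) n \<ge> 0"
  by (simp add: gauss_fps_nth)

lemma gauss_fps_nth_0 [simp]: "fps_nth (gauss_fps a) 0 = 1"
  by (simp add: gauss_fps_nth)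

lemma gauss_fps_nth_Suc:
  "(1 + real n)\<^sup>2 * fps_nth (gauss_fps a) (Suc n) = (a + n)\<^sup>2 * fps_nth (gauss_fps a) n"
  by (simp add: gauss_fps_nth pochhammer_rec' power_mult_distrib power_divide add.commute)

text \<open>Comparing coefficients turns the hypergeometric equation into the recurrence
  \<open>gauss_fps_nth_Suc\<close>, because
  \<open>n * (n - 1) + (2 * a + 1) * n + a^2 = (a + n)^2\<close>.\<close>

lemma gauss_fps_ode:
  "fps_X * (1 - fps_X) * fps_deriv (fps_deriv (gauss_fps a))
    + (1 - fps_const (2 * a + 1) * fps_X) * fps_deriv (gauss_fps a)
    - fps_const (a\<^sup>2) * gauss_fps a = 0"
proof (rule fps_ext)
  fix n
  let ?f = "gauss_fps a"
  have nth: "fps_nth (fps_X * fps_deriv (fps_deriv ?f)) n = n * (1 + n) * fps_nth ?f (Suc n)"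
    "fps_nth (fps_X * (fps_X * fps_deriv (fps_deriv ?f))) n = n * (real n - 1) * fps_nth ?f n"
    "fps_nth (fps_X * fps_deriv ?f) n = n * fps_nth ?f n"
    by (cases n; cases "n - 1"; simp)+
  have split: "fps_X * (1 - fps_X) * fps_deriv (fps_deriv ?f)
      + (1 - fps_const (2 * a + 1) * fps_X) * fps_deriv ?f - fps_const (a\<^sup>2) * ?f
    = fps_X * fps_deriv (fps_deriv ?f) - fps_X * (fps_X * fps_deriv (fps_deriv ?f))
      + fps_deriv ?f - fps_const (2 * a + 1) * (fps_X * fps_deriv ?f) - fps_const (a\<^sup>2) * ?f"
    by (simp add: ring_distribs mult.assoc)
  have "fps_nth (fps_X * (1 - fps_X) * fps_deriv (fps_deriv ?f)
      + (1 - fps_const (2 * a + 1) * fps_X) * fps_deriv ?f - fps_const (a\<^sup>2) * ?f) n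
    = (1 + real n)\<^sup>2 * fps_nth ?f (Suc n) - (a + n)\<^sup>2 * fps_nth ?f n"
    unfolding split fps_sub_nth fps_add_nth fps_mult_left_const_nth nth fps_deriv_nth
    by (simp add: algebra_simps power2_eq_square)
  then show "fps_nth (fps_X * (1 - fps_X) * fps_deriv (fps_deriv ?f)
      + (1 - fps_const (2 * a + 1) * fps_X) * fps_deriv ?f - fps_const (a\<^sup>2) * ?f) n = fps_nth 0 n"
    by (simp add: gauss_fps_nth_Suc)
qed

text \<open>The range of \<open>a\<close> gives \<open>\<bar>a + m\<bar> \<le> m\<close> for every
  integer \<open>m \<ge> 1\<close>, so the left-hand side never exceeds its value at
  \<open>n = 0\<close>. After squaring, the coefficients of \<open>gauss_fps a\<close> are of order
  \<open>1 / n^2\<close>, so the series still converges at 1.\<close>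

lemma pochhammer_fact_bound:
  assumes a: "-2 \<le> a" "a \<le> (0::real)"
  shows "real (Suc n) * \<bar>pochhammer a (Suc n) / fact (Suc n)\<bar> \<le> \<bar>a\<bar>"
proof (induction n)
  case (Suc n)
  have "\<bar>a + real (Suc n)\<bar> \<le> real (Suc n)" using a by (auto simp: abs_le_iff)
  then have "\<bar>pochhammer a (Suc n)\<bar> * \<bar>a + real (Suc n)\<bar> / fact (Suc n)
      \<le> \<bar>pochhammer a (Suc n)\<bar> * real (Suc n) / fact (Suc n)"
    by (intro divide_right_mono mult_left_mono) auto
  moreover have "real (Suc (Suc n)) * \<bar>pochhammer a (Suc (Suc n)) / fact (Suc (Suc n))\<bar>
     = \<bar>pochhammer a (Suc n)\<bar> * \<bar>a + real (Suc n)\<bar> / fact (Suc n)"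
    unfolding pochhammer_rec'[of a "Suc n"] fact_Suc[of "Suc n"]
    by (simp add: abs_mult add_nonneg_pos del: fact_Suc of_nat_Suc)
  ultimately show ?case
    using Suc by (simp add: mult.commute del: fact_Suc of_nat_Suc)
qed simp

lemma gauss_fps_nth_le:
  assumes a: "-2 \<le> a" "a \<le> 0"
  shows "fps_nth (gauss_fps a) (Suc n) \<le> a\<^sup>2 / (real (Suc n))\<^sup>2"
  using power_mono[OF pochhammer_fact_bound[OF assms, of n], of 2]
  by (simp add: gauss_fps_nth power_mult_distrib field_simps del: fact_Suc of_nat_Suc)

lemma summable_gauss_fps:
  assumes "-2 \<le> a" "a \<le> 0"
  shows "summable (fps_nth (gauss_fps a))"
proof -
  have "summable (\<lambda>n. a\<^sup>2 * (1 / (real (Suc n))\<^sup>2))"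
    using inverse_power_summable[of 2, where 'a=real]
    by (intro summable_mult) (subst summable_Suc_iff, simp add: field_simps)
  moreover have "norm (fps_nth (gauss_fps a) (Suc n)) \<le> a\<^sup>2 * (1 / (real (Suc n))\<^sup>2)" for n
    using gauss_fps_nth_le[OF assms, of n] gauss_fps_nth_nonneg[of a "Suc n"] by simp
  ultimately have "summable (\<lambda>n. fps_nth (gauss_fps a) (Suc n))"
    by (rule summable_comparison_test'[where N = 0])
  then show ?thesis by (simp add: summable_Suc_iff)
qed

text \<open>This is Gauss's theorem for \<open>c = 1\<close> and equal upper parameters; the bound
  of order \<open>1 / n^2\<close> on the coefficients supplies both its summability and its limit
  hypothesis.\<close>

lemma suminf_gauss_fps:
  assumes a: "-2 \<le> a" "a \<le> 0"
  shows "suminf (fps_nth (gauss_fps a)) = Gamma (1 - 2 * a) / (Gamma (1 - a))\<^sup>2"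
proof -
  have nth: "fps_nth (gauss_fps a) = gauss_coeff a a 1"
    by (rule ext) (simp add: gauss_fps_def)
  have "(\<lambda>n. n * gauss_coeff a a 1 n) \<longlonglongrightarrow> 0"
  proof (rule LIMSEQ_imp_Suc, rule Lim_null_comparison)
    have "real (Suc n) * fps_nth (gauss_fps a) (Suc n) \<le> a\<^sup>2 * inverse (real (Suc n))" for n
    proof -
      have "real (Suc n) * fps_nth (gauss_fps a) (Suc n) \<le> real (Suc n) * (a\<^sup>2 / (real (Suc n))\<^sup>2)"
        by (intro mult_left_mono gauss_fps_nth_le a) auto
      also have "\<dots> = a\<^sup>2 * inverse (real (Suc n))"
        by (simp add: power2_eq_square field_simps del: of_nat_Suc)
      finally show ?thesis .
    qed
    then show "\<forall>\<^sub>F n in sequentially. norm (real (Suc n) * gauss_coeff a a 1 (Suc n)) \<le> a\<^sup>2 * inverse (real (Suc n))"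
      using gauss_fps_nth_nonneg[of a] unfolding nth by (intro always_eventually) (simp add: abs_mult)
    show "(\<lambda>n. a\<^sup>2 * inverse (real (Suc n))) \<longlonglongrightarrow> 0"
      using tendsto_mult[OF tendsto_const LIMSEQ_inverse_real_of_nat, of "a\<^sup>2"] by simp
  qed
  moreover have "summable (\<lambda>n. \<bar>gauss_coeff a a 1 n\<bar>)"
    using summable_gauss_fps[OF a] gauss_fps_nth_nonneg[of a] by (simp add: nth)
  ultimately show ?thesis
    using a gauss_summation[of 1 a a] unfolding nth by (simp add: power2_eq_square algebra_simps)
qed

lemma Gamma_plus1_pos: "x > 0 \<Longrightarrow> Gamma (x + 1 :: real) = x * Gamma x"
  by (rule Gamma_plus1) (auto elim!: nonpos_Ints_cases')

lemma Gamma_three_halves: "Gamma (3/2 :: real) = sqrt pi / 2"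
  using Gamma_plus1_pos[of "1/2 :: real"] by (simp add: Gamma_one_half_real)

lemma suminf_gauss_fps_minus_half: "suminf (fps_nth (gauss_fps (-1/2))) = 4 / pi"
proof -
  have "Gamma (2 :: real) = 1"
    using Gamma_fact[of 1, where 'a=real] by simp
  then show ?thesis
    using suminf_gauss_fps[of "-1/2"] by (simp add: Gamma_three_halves power_divide)
qed

lemma suminf_gauss_fps_minus_three_halves: "suminf (fps_nth (gauss_fps (-3/2))) = 32 / (3 * pi)"
proof -
  have "Gamma (5/2 :: real) = 3 / 4 * sqrt pi"
    using Gamma_plus1_pos[of "3/2 :: real"] by (simp add: Gamma_three_halves)
  moreover have "Gamma (4 :: real) = 6"
    using Gamma_fact[of 3, where 'a=real] by (simp add: eval_nat_numeral)
  moreover have "suminf (fps_nth (gauss_fps (-3/2))) = Gamma 4 / (Gamma (5/2))\<^sup>2"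
    using suminf_gauss_fps[of "-3/2"] by simp
  ultimately show ?thesis
    by (simp only:) (simp add: power_mult_distrib power_divide)
qed

section \<open>Evaluation of power series on the unit interval\<close>

lemma norm_less_fps_conv_radius:
  fixes f g :: "real fps"
  assumes "norm z < fps_conv_radius f" "norm z < fps_conv_radius g"
  shows "norm z < fps_conv_radius (f + g)" "norm z < fps_conv_radius (f - g)"
    "norm z < fps_conv_radius (f * g)"
  using assms fps_conv_radius_add[of f g] fps_conv_radius_diff[of f g] fps_conv_radius_mult[of f g]
  by (auto simp: min_def split: if_splits intro: less_le_trans)

lemma norm_less_fps_conv_radius_deriv:
  fixes f :: "real fps"
  shows "norm z < fps_conv_radius f \<Longrightarrow> norm z < fps_conv_radius (fps_deriv f)"
  using fps_conv_radius_deriv less_le_trans by blast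

text \<open>The absolute values of the coefficients serve as majorants in the Weierstrass test on
  the closed interval. The point is continuity at 1, which may lie on the boundary of the disc of
  convergence.\<close>

lemma continuous_on_eval_fps_summable:
  fixes f :: "real fps"
  assumes "summable (\<lambda>n. \<bar>fps_nth f n\<bar>)"
  shows "continuous_on {-1..1} (eval_fps f)"
proof -
  have "uniform_limit {-1..1} (\<lambda>n x. \<Sum>i<n. fps_nth f i * x ^ i) (\<lambda>x. \<Sum>i. fps_nth f i * x ^ i) sequentially"
  proof (rule Weierstrass_m_test[OF _ assms])
    fix n and x :: real assume "x \<in> {-1..1}"
    then have "\<bar>x\<bar> ^ n \<le> 1" by (intro power_le_one) auto
    then show "norm (fps_nth f n * x ^ n) \<le> \<bar>fps_nth f n\<bar>"
      using mult_left_mono[of "\<bar>x\<bar> ^ n" 1 "\<bar>fps_nth f n\<bar>"] by (simp add: abs_mult power_abs)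
  qed
  then have "continuous_on {-1..1} (\<lambda>x. \<Sum>i. fps_nth f i * x ^ i)"
    by (rule uniform_limit_theorem[rotated]) (auto intro!: always_eventually continuous_intros)
  then show ?thesis by (simp add: eval_fps_def[abs_def])
qed

lemma eval_fps_ge_nth_0:
  fixes f :: "real fps"
  assumes "\<And>n. fps_nth f n \<ge> 0" "x \<ge> 0" "summable (\<lambda>n. fps_nth f n * x ^ n)"
  shows "eval_fps f x \<ge> fps_nth f 0"
  using sum_le_suminf[OF assms(3), of "{0}"] assms(1,2) by (simp add: eval_fps_def)

lemma gauss_fps_conv_radius:
  assumes "-2 \<le> a" "a \<le> 0"
  shows "fps_conv_radius (gauss_fps a) \<ge> 1"
  using conv_radius_geI[of "fps_nth (gauss_fps a)" 1] summable_gauss_fps[OF assms]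
  by (simp add: fps_conv_radius_def one_ereal_def)

lemma norm_less_gauss_fps_conv_radius:
  fixes u :: real
  assumes "-2 \<le> a" "a \<le> 0" "\<bar>u\<bar> < 1"
  shows "norm u < fps_conv_radius (gauss_fps a)"
proof -
  have "ereal (norm u) < 1" using assms(3) by simp
  then show ?thesis using gauss_fps_conv_radius[OF assms(1,2)] by (rule less_le_trans)
qed

lemma gauss_ode:
  assumes a: "-2 \<le> a" "a \<le> 0" and u: "\<bar>u\<bar> < 1"
  shows "u * (1 - u) * eval_fps (fps_deriv (fps_deriv (gauss_fps a))) u
    + (1 - (2 * a + 1) * u) * eval_fps (fps_deriv (gauss_fps a)) u
    - a\<^sup>2 * eval_fps (gauss_fps a) u = 0"
proof -
  note r = norm_less_gauss_fps_conv_radius[OF assms]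
  have "eval_fps (fps_X * (1 - fps_X) * fps_deriv (fps_deriv (gauss_fps a))
    + (1 - fps_const (2 * a + 1) * fps_X) * fps_deriv (gauss_fps a)
    - fps_const (a\<^sup>2) * gauss_fps a) u = 0"
    unfolding gauss_fps_ode by simp
  then show ?thesis
    using r norm_less_fps_conv_radius_deriv[OF r]
      norm_less_fps_conv_radius_deriv[OF norm_less_fps_conv_radius_deriv[OF r]]
    by (simp add: eval_fps_add eval_fps_diff eval_fps_mult norm_less_fps_conv_radius
        del: real_norm_def)
qed

text \<open>All coefficients are nonnegative, so the series and its derivatives are bounded below by
  their constant terms.\<close>

lemma gauss_eval_bounds:
  assumes a: "-2 \<le> a" "a \<le> 0" and u: "0 \<le> u" "u < 1"
  shows "eval_fps (gauss_fps a) u \<ge> 1" "eval_fps (fps_deriv (gauss_fps a)) u \<ge> a\<^sup>2"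
    "eval_fps (fps_deriv (fps_deriv (gauss_fps a))) u \<ge> 0"
proof -
  have r: "norm u < fps_conv_radius (gauss_fps a)"
    using a u by (intro norm_less_gauss_fps_conv_radius) auto
  note r1 = norm_less_fps_conv_radius_deriv[OF r]
  note r2 = norm_less_fps_conv_radius_deriv[OF r1]
  have n1: "fps_nth (fps_deriv (gauss_fps a)) n \<ge> 0" for n
    by (simp add: gauss_fps_nth_nonneg)
  have n2: "fps_nth (fps_deriv (fps_deriv (gauss_fps a))) n \<ge> 0" for n
    by (simp add: gauss_fps_nth_nonneg)
  show "eval_fps (gauss_fps a) u \<ge> 1"
    using eval_fps_ge_nth_0[OF gauss_fps_nth_nonneg u(1) summable_fps[OF r]] by simp
  show "eval_fps (fps_deriv (gauss_fps a)) u \<ge> a\<^sup>2"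
    using eval_fps_ge_nth_0[OF n1 u(1) summable_fps[OF r1]] by (simp add: gauss_fps_nth)
  show "eval_fps (fps_deriv (fps_deriv (gauss_fps a))) u \<ge> 0"
    using eval_fps_ge_nth_0[OF n2 u(1) summable_fps[OF r2]] n2[of 0] by linarith
qed

text \<open>Equality holds at \<open>n = 0\<close>. From \<open>n\<close> to \<open>n + 1\<close>
  the expression is multiplied by \<open>(n + 1/2) / (n + 1)\<close>, which is less than 1.\<close>

lemma pochhammer_three_halves_bound:
  "(1 + real n) * (2 + real n) * \<bar>pochhammer (-3/2) (Suc (Suc n)) / fact (Suc (Suc n)) :: real\<bar> \<le> 3/4"
proof (induction n)
  case (Suc n)
  let ?e = "\<bar>pochhammer (-3/2) (Suc (Suc n)) / fact (Suc (Suc n)) :: real\<bar>"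
  have abs: "\<bar>- 3/2 + real (Suc (Suc n))\<bar> = real n + 1/2" by simp
  have "(1 + real (Suc n)) * (2 + real (Suc n))
      * \<bar>pochhammer (-3/2) (Suc (Suc (Suc n))) / fact (Suc (Suc (Suc n))) :: real\<bar>
    = (2 + real n) * (?e * \<bar>- 3/2 + real (Suc (Suc n))\<bar>)"
    unfolding pochhammer_rec'[of _ "Suc (Suc n)"] fact_Suc[of "Suc (Suc n)"] abs_divide abs_mult
    by (simp add: divide_simps del: fact_Suc)
  also have "\<dots> \<le> (2 + real n) * (?e * (1 + real n))"
    unfolding abs by (intro mult_left_mono) auto
  also have "\<dots> \<le> 3/4" using Suc by (simp add: mult_ac del: fact_Suc)
  finally show ?case .
qed (simp add: pochhammer_rec' numeral_2_eq_2)

text \<open>Squaring the previous bound shows that coefficient \<open>n\<close> of the second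
  derivative is at most \<open>9/16 / ((n + 1) * (n + 2))\<close>, and these majorants telescope to
  \<open>9/16\<close>. The derivative of the logarithmic quotient is estimated with this
  bound.\<close>

lemma gauss_three_halves_deriv2_le:
  assumes u: "0 \<le> u" "u < 1"
  shows "eval_fps (fps_deriv (fps_deriv (gauss_fps (-3/2)))) u \<le> 9/16"
proof -
  let ?f = "gauss_fps (-3/2)"
  have r: "norm u < fps_conv_radius (fps_deriv (fps_deriv ?f))"
    using u by (intro norm_less_gauss_fps_conv_radius norm_less_fps_conv_radius_deriv) auto
  have "(\<lambda>n. 1 / real (Suc n)) \<longlonglongrightarrow> 0"
    using LIMSEQ_inverse_real_of_nat by (simp add: inverse_eq_divide)
  from sums_mult[OF telescope_sums'[OF this], of "9/16"]
  have tele: "(\<lambda>n. 9/16 * (1 / real (Suc n) - 1 / real (Suc (Suc n)))) sums (9/16)"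
    by simp
  have "fps_nth (fps_deriv (fps_deriv ?f)) n * u ^ n \<le> 9/16 * (1 / real (Suc n) - 1 / real (Suc (Suc n)))" for n
  proof -
    have "((1 + real n) * (2 + real n))\<^sup>2 * fps_nth ?f (Suc (Suc n)) \<le> 9/16"
      using power_mono[OF pochhammer_three_halves_bound[of n], of 2]
      by (simp add: gauss_fps_nth power_mult_distrib power_divide del: fact_Suc)
    then have "(1 + real n) * (2 + real n) * fps_nth ?f (Suc (Suc n)) \<le> 9/16 / ((1 + real n) * (2 + real n))"
      by (subst pos_le_divide_eq) (simp_all add: power2_eq_square mult_ac)
    also have "\<dots> = 9/16 * (1 / real (Suc n) - 1 / real (Suc (Suc n)))"
      by (simp add: divide_simps)
    finally have le: "fps_nth (fps_deriv (fps_deriv ?f)) n \<le> 9/16 * (1 / real (Suc n) - 1 / real (Suc (Suc n)))"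
      by (simp add: mult_ac add_ac)
    have "fps_nth (fps_deriv (fps_deriv ?f)) n * u ^ n \<le> fps_nth (fps_deriv (fps_deriv ?f)) n * 1"
      using u by (intro mult_left_mono power_le_one) (auto simp: gauss_fps_nth_nonneg)
    with le show ?thesis by linarith
  qed
  then show ?thesis
    using sums_le[OF _ sums_eval_fps[OF r] tele] by blast
qed

section \<open>Monotonicity and boundary values of the logarithmic quotient\<close>

definition log_ratio :: "real \<Rightarrow> real" where
  "log_ratio u = ln (eval_fps (gauss_fps (-3/2)) u) - 3/4 * ln (1 + u)
    - 3/2 * ln (eval_fps (gauss_fps (-1/2)) u)"

lemma eval_gauss_fps_1: "eval_fps (gauss_fps a) 1 = suminf (fps_nth (gauss_fps a))"
  by (simp add: eval_fps_def)

lemma log_ratio_0: "log_ratio 0 = 0"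
  by (simp add: log_ratio_def eval_fps_at_0)

lemma log_ratio_1: "log_ratio 1 = 5/4 * ln 2 - ln 3 + ln pi / 2"
proof -
  have "ln (32::real) = 5 * ln 2" "ln (4::real) = 2 * ln 2"
    using ln_realpow[of 2 5] ln_realpow[of 2 2] by simp_all
  then show ?thesis
    unfolding log_ratio_def eval_gauss_fps_1 suminf_gauss_fps_minus_half suminf_gauss_fps_minus_three_halves
    by (simp add: ln_div ln_mult field_simps)
qed

lemma eval_gauss_fps_pos:
  assumes a: "-2 \<le> a" "a \<le> 0" and u: "0 \<le> u" "u \<le> 1"
  shows "eval_fps (gauss_fps a) u > 0"
proof (cases "u = 1")
  case True
  then show ?thesis
    using eval_fps_ge_nth_0[OF gauss_fps_nth_nonneg, of 1 a] summable_gauss_fps[OF a] by simp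
next
  case False
  then show ?thesis using gauss_eval_bounds(1)[OF a u(1)] u by simp
qed

lemma continuous_on_log_ratio: "continuous_on {0..1} log_ratio"
proof -
  have "continuous_on {0..1} (eval_fps (gauss_fps a))" if "-2 \<le> a" "a \<le> 0" for a
    using summable_gauss_fps[OF that] gauss_fps_nth_nonneg[of a]
    by (intro continuous_on_subset[OF continuous_on_eval_fps_summable]) auto
  moreover have "eval_fps (gauss_fps a) u \<noteq> 0" if "-2 \<le> a" "a \<le> 0" "u \<in> {0..1}" for a u
    using eval_gauss_fps_pos[of a u] that by auto
  ultimately show ?thesis
    unfolding log_ratio_def
    by (intro continuous_on_diff continuous_on_mult continuous_on_const continuous_on_ln continuous_on_add continuous_on_id) auto
qed

lemma log_ratio_deriv:
  assumes u: "0 < u" "u < 1"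
  obtains D where "(log_ratio has_real_derivative D) (at u)" "D > 0"
proof -
  let ?F = "gauss_fps (-1/2)" and ?G = "gauss_fps (-3/2)"
  define f f1 f2 where "f = eval_fps ?F u" and "f1 = eval_fps (fps_deriv ?F) u"
    and "f2 = eval_fps (fps_deriv (fps_deriv ?F)) u"
  define g g1 g2 where "g = eval_fps ?G u" and "g1 = eval_fps (fps_deriv ?G) u"
    and "g2 = eval_fps (fps_deriv (fps_deriv ?G)) u"
  have fb: "f \<ge> 1" "f2 \<ge> 0"
    using gauss_eval_bounds[of "-1/2" u] u by (auto simp: f_def f2_def)
  have gb: "g \<ge> 1" "g1 \<ge> 9/4" "g2 \<ge> 0" "g2 \<le> 9/16"
    using gauss_eval_bounds[of "-3/2" u] gauss_three_halves_deriv2_le[of u] u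
    by (auto simp: g_def g1_def g2_def power2_eq_square)
  have "u * (1 - u) * f2 + f1 - f / 4 = 0"
    using gauss_ode[of "-1/2" u] u by (simp add: f_def f1_def f2_def power2_eq_square)
  moreover have "u * (1 - u) * f2 \<ge> 0" using u fb by simp
  \<comment> \<open>The first hypergeometric equation is used only through the sign of its
    second-order term.\<close>
  ultimately have f1: "f1 \<le> f / 4" by linarith
  have "u * (1 - u) * g2 + (1 + 2 * u) * g1 - 9/4 * g = 0"
    using gauss_ode[of "-3/2" u] u by (simp add: g_def g1_def g2_def power2_eq_square)
  then have g: "g = 4/9 * (u * (1 - u) * g2 + (1 + 2 * u) * g1)" by simp
  \<comment> \<open>The second equation eliminates \<open>g\<close>, after which a factor
    \<open>1 - u\<close> splits off.\<close>
  have "(1 + u) * g1 - 3/8 * (3 + u) * g = (1 - u) / 6 * ((3 + 2 * u) * g1 - (3 + u) * (u * g2))"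
    unfolding g by (simp add: field_simps power2_eq_square)
  moreover have "(3 + u) * (u * g2) < (3 + 2 * u) * g1"
  proof -
    \<comment> \<open>The margin is comfortable: \<open>u * g2 \<le> 9/16\<close> while
      \<open>g1 \<ge> 9/4\<close>, and also \<open>3 + u < 3 + 2 * u\<close>.\<close>
    have "u * g2 \<le> 1 * (9/16)" using u gb by (intro mult_mono) auto
    then show ?thesis using u gb by (intro mult_strict_mono) auto
  qed
  then have "(1 - u) / 6 * ((3 + 2 * u) * g1 - (3 + u) * (u * g2)) > 0"
    using u by (intro mult_pos_pos) auto
  ultimately have G: "(1 + u) * g1 > 3/8 * (3 + u) * g"
    by linarith
  let ?D = "g1 / g - 3/4 * (1 / (1 + u)) - 3/2 * (f1 / f)"
  have rf: "norm u < fps_conv_radius ?F" and rg: "norm u < fps_conv_radius ?G"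
    using u by (auto intro!: norm_less_gauss_fps_conv_radius simp del: real_norm_def)
  define FF GG where "FF = eval_fps ?F" and "GG = eval_fps ?G"
  have FF: "(FF has_real_derivative f1) (at u)" "FF u = f"
    using has_field_derivative_eval_fps[OF rf] by (simp_all add: FF_def f1_def f_def)
  have GG: "(GG has_real_derivative g1) (at u)" "GG u = g"
    using has_field_derivative_eval_fps[OF rg] by (simp_all add: GG_def g1_def g_def)
  have "((\<lambda>u. ln (GG u) - 3/4 * ln (1 + u) - 3/2 * ln (FF u)) has_real_derivative ?D) (at u)"
    using u fb gb by (auto intro!: derivative_eq_intros FF(1) GG(1) simp: FF(2) GG(2))
      (simp add: divide_simps)
  then have "(log_ratio has_real_derivative ?D) (at u)"
    unfolding log_ratio_def[abs_def] FF_def GG_def .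
  moreover have "?D > 0"
  proof -
    have "3/8 * (3 + u) / (1 + u) < g1 / g"
      using G u gb by (simp add: field_simps)
    \<comment> \<open>The lower bound for \<open>g1 / g\<close> has been chosen to match: its first
      part cancels the derivative of \<open>3/4 * ln (1 + u)\<close>, and \<open>3/8\<close> is
      \<open>3/2\<close> times the bound \<open>1/4\<close> for \<open>f1 / f\<close>.\<close>
    moreover have "3/8 * (3 + u) / (1 + u) = 3/4 * (1 / (1 + u)) + 3/8"
      using u by (simp add: field_simps)
    moreover have "f1 / f \<le> 1/4" using f1 fb by (simp add: field_simps)
    ultimately show ?thesis by linarith
  qed
  ultimately show ?thesis by (rule that)
qed

text \<open>Differentiability is available only inside the interval; the end points, in particular
  1, are reached by continuity.\<close>

lemma log_ratio_strict_mono: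
  assumes "0 \<le> x" "x < y" "y \<le> 1"
  shows "log_ratio x < log_ratio y"
proof (rule DERIV_pos_imp_increasing_open[OF assms(2)])
  fix u assume "x < u" "u < y"
  then show "\<exists>D. DERIV log_ratio u :> D \<and> D > 0"
    using log_ratio_deriv[of u] assms by force
qed (use assms in \<open>auto intro: continuous_on_subset[OF continuous_on_log_ratio]\<close>)

section \<open>Pullback along \<open>4x / (1-x)\<^sup>2\<close>\<close>

lemma fps_power_nth_nonneg:
  fixes g :: "real fps"
  assumes "\<And>n. fps_nth g n \<ge> 0"
  shows "fps_nth (g ^ k) n \<ge> 0"
  by (induction k arbitrary: n) (auto simp: fps_mult_nth assms intro!: sum_nonneg mult_nonneg_nonneg)

text \<open>Expanding the powers of \<open>g\<close> gives a double series with nonnegative terms,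
  so the order of summation may be exchanged. Summing over \<open>n\<close> first gives the value of
  \<open>f\<close> at \<open>eval_fps g x\<close>; summing over \<open>i\<close> first gives the
  coefficients of the composition.\<close>

lemma fps_compose_sums:
  fixes f g :: "real fps"
  assumes f: "\<And>n. fps_nth f n \<ge> 0" and g: "\<And>n. fps_nth g n \<ge> 0" and g0: "fps_nth g 0 = 0"
    and x: "x \<ge> 0" "norm x < fps_conv_radius g" "norm (eval_fps g x) < fps_conv_radius f"
  shows "(\<lambda>n. fps_nth (f oo g) n * x ^ n) sums eval_fps f (eval_fps g x)"
proof -
  define h where "h = (\<lambda>(i, n). fps_nth f i * fps_nth (g ^ i) n * x ^ n)"
  have h0: "h p \<ge> 0" for p
    by (cases p) (simp add: h_def f fps_power_nth_nonneg[OF g] x)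
  have row: "((\<lambda>n. h (i, n)) has_sum (fps_nth f i * eval_fps g x ^ i)) UNIV" for i
  proof -
    have "(\<lambda>n. fps_nth (g ^ i) n * x ^ n) sums (eval_fps g x ^ i)"
      using sums_eval_fps[of x "g ^ i"] eval_fps_power[OF x(2), of i] x(2) fps_conv_radius_power[of g i]
      by (metis less_le_trans)
    from sums_mult[OF this, of "fps_nth f i"] show ?thesis
      using h0[of "(i, _)"] by (intro sums_nonneg_imp_has_sum) (simp_all add: h_def mult.assoc)
  qed
  have y: "eval_fps g x \<ge> 0"
    using eval_fps_ge_nth_0[OF g x(1) summable_fps[OF x(2)]] g0 by simp
  have col: "((\<lambda>i. fps_nth f i * eval_fps g x ^ i) has_sum eval_fps f (eval_fps g x)) UNIV"
    using sums_eval_fps[OF x(3)] y f by (intro sums_nonneg_imp_has_sum) simp_all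
  have "(h has_sum eval_fps f (eval_fps g x)) (UNIV \<times> UNIV)"
    using h0 by (intro has_sum_SigmaI[OF row col] summable_on_SigmaI[OF row]) 
      (auto intro: has_sum_imp_summable[OF col])
  then have swapped: "((\<lambda>(n, i). h (i, n)) has_sum eval_fps f (eval_fps g x)) (UNIV \<times> UNIV)"
    by (subst (asm) has_sum_swap) simp
  have "((\<lambda>i. h (i, n)) has_sum (fps_nth (f oo g) n * x ^ n)) UNIV" for n
  proof -
    \<comment> \<open>Since \<open>g\<close> has no constant term, \<open>g ^ i\<close> starts at
      degree \<open>i\<close> or later, and so each column is finite.\<close>
    have "h (i, n) = 0" if "i \<notin> {0..n}" for i
      using that startsby_zero_power_prefix[OF g0, of i] by (simp add: h_def)
    then have "((\<lambda>i. h (i, n)) has_sum (\<Sum>i\<in>{0..n}. h (i, n))) UNIV"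
      by (intro has_sum_finite_neutralI) auto
    then show ?thesis
      by (simp add: h_def fps_compose_nth sum_distrib_right)
  qed
  then have "((\<lambda>n. fps_nth (f oo g) n * x ^ n) has_sum eval_fps f (eval_fps g x)) UNIV"
    by (intro has_sum_SigmaD[OF swapped]) simp
  then show ?thesis by (rule has_sum_imp_sums)
qed

section \<open>The geometric series and the substitution as a power series\<close>

definition geo :: "real fps" where "geo = Abs_fps (\<lambda>_. 1)"

lemma geo_mult: "geo * (1 - fps_X) = 1"
  unfolding geo_def by (rule fps_ext) (auto simp: right_diff_distrib)

lemma geo_conv_radius: "fps_conv_radius geo \<ge> 1"
  unfolding fps_conv_radius_def
  by (rule conv_radius_geI_ex') (auto simp: geo_def summable_geometric)

lemma norm_less_geo_conv_radius:
  fixes x :: real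
  assumes "\<bar>x\<bar> < 1"
  shows "norm x < fps_conv_radius (geo ^ k)"
proof -
  have "ereal (norm x) < 1" using assms by simp
  also note geo_conv_radius
  also note fps_conv_radius_power
  finally show ?thesis .
qed

lemma eval_fps_geo_power:
  fixes x :: real
  assumes "\<bar>x\<bar> < 1"
  shows "eval_fps (geo ^ k) x = (1 / (1 - x)) ^ k"
  using eval_fps_power[of x geo k] norm_less_geo_conv_radius[OF assms, of 1]
    suminf_geometric[of x] assms
  by (simp add: eval_fps_def geo_def)

lemma fps_mult_nth_nonneg:
  fixes f g :: "real fps"
  assumes "\<And>n. fps_nth f n \<ge> 0" "\<And>n. fps_nth g n \<ge> 0"
  shows "fps_nth (f * g) n \<ge> 0"
  by (auto simp: fps_mult_nth assms intro!: sum_nonneg)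

lemma geo_power_nth_nonneg: "fps_nth (geo ^ k) n \<ge> 0"
  by (rule fps_power_nth_nonneg) (simp add: geo_def)

text \<open>Four times the Koebe function \<open>X / (1 - X)^2\<close>. Writing it with
  \<open>geo\<close> instead of a quotient makes the nonnegativity of its coefficients
  visible.\<close>

definition Koebe :: "real fps" where "Koebe = fps_const 4 * (fps_X * geo\<^sup>2)"

lemma Koebe_nth_nonneg: "fps_nth Koebe n \<ge> 0"
  by (simp add: Koebe_def geo_power_nth_nonneg)

lemma Koebe_nth_0 [simp]: "fps_nth Koebe 0 = 0"
  by (simp add: Koebe_def)

lemma norm_less_Koebe_conv_radius:
  fixes x :: real
  assumes "\<bar>x\<bar> < 1"
  shows "norm x < fps_conv_radius Koebe"
  unfolding Koebe_def
  by (intro norm_less_fps_conv_radius norm_less_geo_conv_radius assms) simp_all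

lemma eval_fps_Koebe:
  fixes x :: real
  assumes "\<bar>x\<bar> < 1"
  shows "eval_fps Koebe x = 4 * x / (1 - x)\<^sup>2"
  unfolding Koebe_def using norm_less_geo_conv_radius[OF assms, of 2]
  by (simp add: eval_fps_mult norm_less_fps_conv_radius eval_fps_geo_power[OF assms] power_divide
      del: real_norm_def)

text \<open>Here and in the next two lemmas denominators are cleared, so that the change of variable
  becomes a matter of polynomial identities.\<close>

lemma Koebe_mult: "Koebe * (1 - fps_X)\<^sup>2 = 4 * fps_X"
proof -
  have "Koebe * (1 - fps_X)\<^sup>2 = 4 * fps_X * (geo * (1 - fps_X))\<^sup>2"
    unfolding Koebe_def by (simp add: power_mult_distrib mult_ac numeral_fps_const)
  then show ?thesis by (simp add: geo_mult)
qed

lemma Koebe_deriv: "fps_deriv Koebe * (1 - fps_X) ^ 3 = 4 * (1 + fps_X)"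
proof -
  have "fps_deriv (Koebe * (1 - fps_X)\<^sup>2) = 4" by (simp add: Koebe_mult)
  then have "fps_deriv Koebe * (1 - fps_X)\<^sup>2 = 4 + 2 * Koebe * (1 - fps_X)"
    by (simp add: power2_eq_square algebra_simps)
  then have "fps_deriv Koebe * (1 - fps_X) ^ 3 = 4 * (1 - fps_X) + 2 * (Koebe * (1 - fps_X)\<^sup>2)"
    by algebra
  then show ?thesis unfolding Koebe_mult by (simp add: algebra_simps)
qed

text \<open>This explains the quadratic factor in both given differential equations: its roots lie
  over the singular point 1 of the hypergeometric equation.\<close>

lemma Koebe_discriminant: "(1 - fps_X)\<^sup>2 * (1 - Koebe) = fps_X\<^sup>2 - 6 * fps_X + 1"
  using Koebe_mult by algebra

text \<open>The hypergeometric equation is composed with \<open>Koebe\<close>, and the chain rule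
  expresses the inner derivatives \<open>y1\<close> and \<open>y2\<close> through those of
  \<open>y\<close>. Denominators are powers of \<open>d = 1 - X\<close>, which are cleared
  throughout and cancelled at the end.\<close>

lemma gauss_Koebe_ode:
  fixes a :: real
  defines "y \<equiv> gauss_fps a oo Koebe"
  shows "fps_X * (fps_X\<^sup>2 - 6 * fps_X + 1) * (1 - fps_X)\<^sup>2 * (1 + fps_X) * fps_deriv (fps_deriv y)
    + ((1 + fps_X)\<^sup>2 * (1 - fps_X) * ((1 - fps_X)\<^sup>2 - 4 * fps_const (2 * a + 1) * fps_X)
      - (4 + 2 * fps_X) * fps_X * (fps_X\<^sup>2 - 6 * fps_X + 1) * (1 - fps_X)) * fps_deriv y
    - 4 * fps_const (a\<^sup>2) * (1 + fps_X) ^ 3 * y = 0" (is "?E = 0")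
proof -
  define c e where "c = fps_const (2 * a + 1)" and "e = fps_const (a\<^sup>2)"
  define d q K where "d = 1 - (fps_X :: real fps)" and "q = fps_X\<^sup>2 - 6 * fps_X + (1 :: real fps)"
    and "K = Koebe"
  define y1 y2 where "y1 = fps_deriv (gauss_fps a) oo Koebe"
    and "y2 = fps_deriv (fps_deriv (gauss_fps a)) oo Koebe"
  have K: "K * d\<^sup>2 = 4 * fps_X" "d\<^sup>2 * (1 - K) = q"
    using Koebe_mult Koebe_discriminant by (simp_all add: K_def d_def q_def)
  have d': "fps_deriv d = -1" by (simp add: d_def)
  have "(fps_X * (1 - fps_X) * fps_deriv (fps_deriv (gauss_fps a))
    + (1 - c * fps_X) * fps_deriv (gauss_fps a) - e * gauss_fps a) oo Koebe = 0"
    unfolding c_def e_def gauss_fps_ode by simp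
  then have "K * (1 - K) * y2 + (1 - c * K) * y1 - e * y = 0"
    unfolding c_def e_def K_def y_def y1_def y2_def
    by (simp add: fps_compose_add_distrib fps_compose_sub_distrib fps_compose_mult_distrib)
  moreover have "d^4 * (K * (1 - K) * y2 + (1 - c * K) * y1 - e * y)
      = (K * d\<^sup>2) * (d\<^sup>2 * (1 - K)) * y2 + d\<^sup>2 * (d\<^sup>2 - c * (K * d\<^sup>2)) * y1 - d^4 * e * y"
    by algebra
  ultimately have ode: "4 * fps_X * q * y2 + d\<^sup>2 * (d\<^sup>2 - c * (4 * fps_X)) * y1 - d^4 * e * y = 0"
    unfolding K by simp
  have dy: "d^3 * fps_deriv y = 4 * (1 + fps_X) * y1"
    using Koebe_deriv unfolding y_def y1_def d_def
    by (simp add: fps_compose_deriv mult_ac)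
  have dy1: "d^3 * fps_deriv y1 = 4 * (1 + fps_X) * y2"
    using Koebe_deriv unfolding y1_def y2_def d_def
    by (simp add: fps_compose_deriv mult_ac)
  have "fps_deriv (d^3 * fps_deriv y) = d^3 * fps_deriv (fps_deriv y) - 3 * d\<^sup>2 * fps_deriv y"
    by (simp add: power3_eq_cube power2_eq_square d' algebra_simps)
  moreover have "fps_deriv (4 * (1 + fps_X) * y1) = 4 * y1 + 4 * (1 + fps_X) * fps_deriv y1"
    by (simp add: algebra_simps)
  ultimately have ddy: "d^3 * fps_deriv (fps_deriv y) - 3 * d\<^sup>2 * fps_deriv y
      = 4 * y1 + 4 * (1 + fps_X) * fps_deriv y1"
    using dy by simp
  have E: "?E = fps_X * q * d\<^sup>2 * (1 + fps_X) * fps_deriv (fps_deriv y)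
    + ((1 + fps_X)\<^sup>2 * d * (d\<^sup>2 - 4 * c * fps_X) - (4 + 2 * fps_X) * fps_X * q * d) * fps_deriv y
    - 4 * e * (1 + fps_X) ^ 3 * y"
    by (simp add: q_def d_def c_def e_def)
  have "d^4 * ?E = 4 * (1 + fps_X) ^ 3 * (4 * fps_X * q * y2 + d\<^sup>2 * (d\<^sup>2 - c * (4 * fps_X)) * y1 - d^4 * e * y)"
    unfolding E using dy dy1 ddy d_def by algebra
  then have "d^4 * ?E = 0" unfolding ode by simp
  moreover have "fps_nth d 0 = 1" by (simp add: d_def)
  then have "d \<noteq> 0" by auto
  ultimately show ?thesis by simp
qed

section \<open>Closed forms of the two power series\<close>

text \<open>In the next two lemmas \<open>y\<close> and \<open>b\<close> play the role of the pulled back hypergeometric series and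
  of the closed form, \<open>y1\<close>, \<open>y2\<close>, \<open>b1\<close>, \<open>b2\<close> that of their derivatives; \<open>e1\<close> and \<open>e2\<close> are the
  derivatives of \<open>e0\<close>.\<close>

lemma A_fps_ode:
  fixes x b b1 b2 y y1 y2 :: "'a :: idom"
  defines "q \<equiv> x^2 - 6 * x + 1" and "d \<equiv> 1 - x"
  assumes q: "q \<noteq> 0"
    and e0: "q^2 * b = 4 * (1 - x^2) * y"
    and e1: "q^2 * b1 + 2 * q * (2 * x - 6) * b = 4 * (1 - x^2) * y1 - 8 * x * y"
    and e2: "q^2 * b2 + 4 * q * (2 * x - 6) * b1 + (2 * (2 * x - 6)^2 + 4 * q) * b
      = 4 * (1 - x^2) * y2 - 16 * x * y1 - 8 * y"
    and ode: "x * q * d^2 * (1 + x) * y2 + ((1 + x)^2 * d^3 - (4 + 2 * x) * x * q * d) * y1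
      - (1 + x)^3 * y = 0"
  shows "x * (x - 1) * q * (x + 1)^2 * b2
     + (x + 1) * (5 * x^4 - 8 * x^3 - 32 * x^2 + 28 * x - 1) * b1
     + (4 * x^4 + 11 * x^3 - x^2 - 43 * x + 13) * b = 0" (is "?E = 0")
proof -
  define p where "p = x * (x - 1) * q * (x + 1)^2"
  define s where "s = (x + 1) * (5 * x^4 - 8 * x^3 - 32 * x^2 + 28 * x - 1)"
  define r where "r = 4 * x^4 + 11 * x^3 - x^2 - 43 * x + 13"
  \<comment> \<open>The factor \<open>q^4\<close> allows \<open>b2\<close>, \<open>b1\<close> and
    \<open>b\<close> to be eliminated in this order by \<open>e2\<close>, \<open>e1\<close> and
    \<open>e0\<close> without division. What remains is a multiple of the equation for
    \<open>y\<close>.\<close>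
  have "q^4 * (p * b2 + s * b1 + r * b) =
      q^2 * p * (4 * (1 - x^2) * y2 - 16 * x * y1 - 8 * y)
      + (s * q^2 - 4 * p * q * (2 * x - 6)) * (4 * (1 - x^2) * y1 - 8 * x * y)
      + (r * q^2 - p * (2 * (2 * x - 6)^2 + 4 * q) - 2 * s * q * (2 * x - 6) + 8 * p * (2 * x - 6)^2)
        * (4 * (1 - x^2) * y)"
    unfolding e0[symmetric] e1[symmetric] e2[symmetric]
    by (simp add: algebra_simps power2_eq_square power4_eq_xxxx)
  also have "\<dots> = - 4 * q^2 * (1 + x)^2 * (x * q * d^2 * (1 + x) * y2
      + ((1 + x)^2 * d^3 - (4 + 2 * x) * x * q * d) * y1 - (1 + x)^3 * y)"
    unfolding p_def s_def r_def q_def d_def by algebra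
  also have "\<dots> = 0" unfolding ode by simp
  finally show ?thesis using q unfolding p_def s_def r_def by simp
qed

lemma V_fps_ode:
  fixes x b b1 b2 y y1 y2 :: "'a :: idom"
  defines "q \<equiv> x^2 - 6 * x + 1" and "d \<equiv> 1 - x"
  assumes q: "q \<noteq> 0"
    and e0: "q^3 * b = 2 * d^3 * y"
    and e1: "q^3 * b1 + 3 * q^2 * (2 * x - 6) * b = 2 * d^3 * y1 - 6 * d^2 * y"
    and e2: "q^3 * b2 + 6 * q^2 * (2 * x - 6) * b1 + (6 * q * (2 * x - 6)^2 + 6 * q^2) * b
      = 2 * d^3 * y2 - 12 * d^2 * y1 + 12 * d * y"
    and ode: "x * q * d^2 * (1 + x) * y2 + ((1 + x)^2 * d * (d^2 + 8 * x) - (4 + 2 * x) * x * q * d) * y1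
      - 9 * (1 + x)^3 * y = 0"
  shows "x * (x - 1) * (x + 1) * q^2 * b2
     + q * (7 * x^4 - 22 * x^3 - 18 * x^2 + 26 * x - 1) * b1
     + 3 * (3 * x^5 - 24 * x^4 - 2 * x^3 + 56 * x^2 - 25 * x + 8) * b = 0" (is "?E = 0")
proof -
  define p where "p = x * (x - 1) * (x + 1) * q^2"
  define s where "s = q * (7 * x^4 - 22 * x^3 - 18 * x^2 + 26 * x - 1)"
  define r where "r = 3 * (3 * x^5 - 24 * x^4 - 2 * x^3 + 56 * x^2 - 25 * x + 8)"
  \<comment> \<open>The same triangular elimination; the exponent is 5 because \<open>b\<close> now
    carries \<open>q^3\<close> and two derivatives raise this by 2.\<close>
  have "q^5 * (p * b2 + s * b1 + r * b) =
      q^2 * p * (2 * d^3 * y2 - 12 * d^2 * y1 + 12 * d * y)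
      + (s * q^2 - 6 * p * q * (2 * x - 6)) * (2 * d^3 * y1 - 6 * d^2 * y)
      + (r * q^2 - p * (6 * (2 * x - 6)^2 + 6 * q) - 3 * s * q * (2 * x - 6) + 18 * p * (2 * x - 6)^2)
        * (2 * d^3 * y)"
    unfolding e0[symmetric] e1[symmetric] e2[symmetric]
    by (simp add: algebra_simps eval_nat_numeral)
  also have "\<dots> = - 2 * q^3 * d^2 * (x * q * d^2 * (1 + x) * y2
      + ((1 + x)^2 * d * (d^2 + 8 * x) - (4 + 2 * x) * x * q * d) * y1 - 9 * (1 + x)^3 * y)"
    unfolding p_def s_def r_def q_def d_def by algebra
  also have "\<dots> = 0" unfolding ode by simp
  finally show ?thesis using q unfolding p_def s_def r_def by simp
qed

lemma geo_compose_Koebe: "(geo oo Koebe) * (1 - Koebe) = 1"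
proof -
  have "(geo * (1 - fps_X)) oo Koebe = 1" unfolding geo_mult by simp
  then show ?thesis by (simp add: fps_compose_mult_distrib fps_compose_sub_distrib)
qed

lemma discriminant_nonzero: "fps_X\<^sup>2 - 6 * fps_X + 1 \<noteq> (0 :: real fps)"
proof -
  have "fps_nth (fps_X\<^sup>2 - 6 * fps_X + 1 :: real fps) 0 = 1" by (simp add: power2_eq_square)
  then show ?thesis by (metis fps_zero_nth zero_neq_one)
qed

text \<open>By \<open>Koebe_discriminant\<close>, this is \<open>4 * (1 - X^2) / q^2\<close> times
  the pulled back series, with the powers of \<open>1 - Koebe\<close> moved inside the composition
  as powers of \<open>geo\<close>. Only series with nonnegative coefficients are then composed, as
  \<open>fps_compose_sums\<close> requires.\<close>

lemma A_bar_eq: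
  "A_bar = fps_const 4 * ((1 + fps_X) * (geo^3 * (geo\<^sup>2 * gauss_fps (-1/2) oo Koebe)))" (is "_ = ?B")
proof -
  define y where "y = gauss_fps (-1/2) oo Koebe"
  define k where "k = geo oo Koebe"
  define b where "b = ?B"
  define d q where "d = 1 - (fps_X :: real fps)" and "q = fps_X^2 - 6 * fps_X + (1 :: real fps)"
  have q': "fps_deriv q = 2 * fps_X - 6" by (simp add: q_def power2_eq_square)
  have B: "b = 4 * ((1 + fps_X) * (geo^3 * (k\<^sup>2 * y)))"
    by (simp add: fps_compose_mult_distrib fps_compose_power[symmetric] b_def k_def y_def numeral_fps_const)
  have q: "q = d\<^sup>2 * (1 - Koebe)" by (simp add: q_def d_def Koebe_discriminant)
  have "q^2 * b = 4 * (1 + fps_X) * d * (geo * d)^3 * (k * (1 - Koebe))\<^sup>2 * y"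
    unfolding B q by algebra
  then have e0: "q^2 * b = 4 * (1 - fps_X^2) * y"
    unfolding d_def k_def geo_mult geo_compose_Koebe by (simp add: algebra_simps power2_eq_square)
  \<comment> \<open>Differentiating \<open>e0\<close> twice supplies the remaining hypotheses
    \<open>e1\<close> and \<open>e2\<close> of \<open>A_fps_ode\<close>.\<close>
  have L: "fps_deriv (q^2 * b) = q^2 * fps_deriv b + 2 * q * (2 * fps_X - 6) * b"
    by (simp add: power2_eq_square q' algebra_simps)
  have R: "fps_deriv (4 * (1 - fps_X^2) * y) = 4 * (1 - fps_X^2) * fps_deriv y - 8 * fps_X * y"
    by (simp add: power2_eq_square algebra_simps)
  have e1: "q^2 * fps_deriv b + 2 * q * (2 * fps_X - 6) * b
      = 4 * (1 - fps_X^2) * fps_deriv y - 8 * fps_X * y"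
    using arg_cong[OF e0, of fps_deriv] unfolding L R .
  have L: "fps_deriv (q^2 * fps_deriv b + 2 * q * (2 * fps_X - 6) * b)
      = q^2 * fps_deriv (fps_deriv b) + 4 * q * (2 * fps_X - 6) * fps_deriv b
        + (2 * (2 * fps_X - 6)^2 + 4 * q) * b"
    by (simp add: power2_eq_square q' algebra_simps)
  have R: "fps_deriv (4 * (1 - fps_X^2) * fps_deriv y - 8 * fps_X * y)
      = 4 * (1 - fps_X^2) * fps_deriv (fps_deriv y) - 16 * fps_X * fps_deriv y - 8 * y"
    by (simp add: power2_eq_square algebra_simps)
  have e2: "q^2 * fps_deriv (fps_deriv b) + 4 * q * (2 * fps_X - 6) * fps_deriv b
        + (2 * (2 * fps_X - 6)^2 + 4 * q) * b
      = 4 * (1 - fps_X^2) * fps_deriv (fps_deriv y) - 16 * fps_X * fps_deriv y - 8 * y"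
    using arg_cong[OF e1, of fps_deriv] unfolding L R .
  have quarter: "4 * fps_const (1/4 :: real) = 1"
    by (simp add: numeral_fps_const)
  have ode: "fps_X * q * d^2 * (1 + fps_X) * fps_deriv (fps_deriv y)
      + ((1 + fps_X)^2 * d^3 - (4 + 2 * fps_X) * fps_X * q * d) * fps_deriv y
      - (1 + fps_X)^3 * y = 0"
    using gauss_Koebe_ode[of "-1/2"] quarter
    by (simp add: y_def q_def d_def power2_eq_square power3_eq_cube mult_ac)
  have "ode_A b"
    unfolding ode_A_def
    using A_fps_ode[OF discriminant_nonzero e0[unfolded q_def] e1[unfolded q_def]
        e2[unfolded q_def] ode[unfolded q_def d_def]]
    by simp
  moreover have "fps_nth b 0 = 4"
    by (simp add: b_def geo_def fps_power_zeroth)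
  ultimately show ?thesis
    unfolding A_bar_def b_def by (intro the1_equality[OF ex1_A_bar]) simp
qed

text \<open>As for \<open>A_bar_eq\<close>, now starting from \<open>2 * (1 - X)^3 / q^3\<close>
  times the pulled back series; uniqueness of the solution with constant term 2 finishes the
  identification.\<close>

lemma V_bar_eq:
  "V_bar = fps_const 2 * (geo^3 * (geo^3 * gauss_fps (-3/2) oo Koebe))" (is "_ = ?B")
proof -
  define y where "y = gauss_fps (-3/2) oo Koebe"
  define k where "k = geo oo Koebe"
  define b where "b = ?B"
  define d q where "d = 1 - (fps_X :: real fps)" and "q = fps_X^2 - 6 * fps_X + (1 :: real fps)"
  have q': "fps_deriv q = 2 * fps_X - 6" by (simp add: q_def power2_eq_square)
  have d': "fps_deriv d = -1" by (simp add: d_def)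
  have B: "b = 2 * (geo^3 * (k^3 * y))"
    by (simp add: fps_compose_mult_distrib fps_compose_power[symmetric] b_def k_def y_def numeral_fps_const)
  have q: "q = d\<^sup>2 * (1 - Koebe)" by (simp add: q_def d_def Koebe_discriminant)
  have "q^3 * b = 2 * d^3 * (geo * d)^3 * (k * (1 - Koebe))^3 * y"
    unfolding B q by algebra
  then have e0: "q^3 * b = 2 * d^3 * y"
    unfolding d_def k_def geo_mult geo_compose_Koebe by simp
  have L: "fps_deriv (q^3 * b) = q^3 * fps_deriv b + 3 * q^2 * (2 * fps_X - 6) * b"
    by (simp add: power2_eq_square power3_eq_cube q' algebra_simps)
  have R: "fps_deriv (2 * d^3 * y) = 2 * d^3 * fps_deriv y - 6 * d^2 * y"
    by (simp add: power2_eq_square power3_eq_cube d' algebra_simps)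
  have e1: "q^3 * fps_deriv b + 3 * q^2 * (2 * fps_X - 6) * b
      = 2 * d^3 * fps_deriv y - 6 * d^2 * y"
    using arg_cong[OF e0, of fps_deriv] unfolding L R .
  have L: "fps_deriv (q^3 * fps_deriv b + 3 * q^2 * (2 * fps_X - 6) * b)
      = q^3 * fps_deriv (fps_deriv b) + 6 * q^2 * (2 * fps_X - 6) * fps_deriv b
        + (6 * q * (2 * fps_X - 6)^2 + 6 * q^2) * b"
    by (simp add: power2_eq_square power3_eq_cube q' algebra_simps)
  have R: "fps_deriv (2 * d^3 * fps_deriv y - 6 * d^2 * y)
      = 2 * d^3 * fps_deriv (fps_deriv y) - 12 * d^2 * fps_deriv y + 12 * d * y"
    by (simp add: power2_eq_square power3_eq_cube d' algebra_simps)
  have e2: "q^3 * fps_deriv (fps_deriv b) + 6 * q^2 * (2 * fps_X - 6) * fps_deriv b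
        + (6 * q * (2 * fps_X - 6)^2 + 6 * q^2) * b
      = 2 * d^3 * fps_deriv (fps_deriv y) - 12 * d^2 * fps_deriv y + 12 * d * y"
    using arg_cong[OF e1, of fps_deriv] unfolding L R .
  have nine: "4 * fps_const (9/4 :: real) = 9" "4 * fps_const (-2 :: real) = -8"
    by (simp_all add: numeral_fps_const)
  have ode: "fps_X * q * d^2 * (1 + fps_X) * fps_deriv (fps_deriv y)
      + ((1 + fps_X)^2 * d * (d^2 + 8 * fps_X) - (4 + 2 * fps_X) * fps_X * q * d) * fps_deriv y
      - 9 * (1 + fps_X)^3 * y = 0"
    using gauss_Koebe_ode[of "-3/2"] nine
    by (simp add: y_def q_def d_def power2_eq_square)
  have "ode_V b"
    unfolding ode_V_def
    using V_fps_ode[OF discriminant_nonzero e0[unfolded q_def d_def] e1[unfolded q_def d_def]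
        e2[unfolded q_def d_def] ode[unfolded q_def d_def]]
    by simp
  moreover have "fps_nth b 0 = 2"
    by (simp add: b_def geo_def fps_power_zeroth)
  ultimately show ?thesis
    unfolding V_bar_def b_def by (intro the1_equality[OF ex1_V_bar]) simp
qed

section \<open>Values of the two series below the smaller root of the quadratic factor\<close>

lemma Koebe_range:
  fixes x :: real
  assumes "0 \<le> x" "x < 3 - 2 * sqrt 2"
  shows "x < 1" "0 \<le> 4 * x / (1 - x)\<^sup>2" "4 * x / (1 - x)\<^sup>2 < 1"
proof -
  \<comment> \<open>\<open>3 - 2 * sqrt 2\<close> is the smaller root of
    \<open>x^2 - 6 * x + 1 = (3 - x)^2 - 8\<close>, whose positivity is the inequality
    \<open>4 * x < (1 - x)^2\<close>.\<close>
  have "3 - x > 2 * sqrt 2" using assms by simp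
  then have "(2 * sqrt 2)\<^sup>2 < (3 - x)\<^sup>2" by (intro power_strict_mono) auto
  then have "4 * x < (1 - x)\<^sup>2" by (simp add: power2_eq_square algebra_simps)
  moreover have "sqrt 2 > 1" by simp
  then show x: "x < 1" using assms by linarith
  ultimately show "4 * x / (1 - x)\<^sup>2 < 1" by (simp add: divide_less_eq)
  show "0 \<le> 4 * x / (1 - x)\<^sup>2" using assms by simp
qed

lemma compose_Koebe_eval:
  assumes f: "\<And>n. fps_nth f n \<ge> 0" "fps_conv_radius f \<ge> 1"
    and x: "0 \<le> x" "x < 3 - 2 * sqrt 2"
  shows "eval_fps (f oo Koebe) x = eval_fps f (4 * x / (1 - x)\<^sup>2)"
    and "norm x < fps_conv_radius (f oo Koebe)"
proof -
  have s: "(\<lambda>n. fps_nth (f oo Koebe) n * r ^ n) sums eval_fps f (4 * r / (1 - r)\<^sup>2)"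
    if "0 \<le> r" "r < 3 - 2 * sqrt 2" for r
  proof -
    note k = Koebe_range[OF that]
    have r1: "\<bar>r\<bar> < 1" using k that by simp
    have "ereal (norm (eval_fps Koebe r)) < 1"
      unfolding eval_fps_Koebe[OF r1] real_norm_def abs_of_nonneg[OF k(2)] using k(3) by simp
    then have "norm (eval_fps Koebe r) < fps_conv_radius f"
      using f(2) by (rule less_le_trans)
    from fps_compose_sums[OF f(1) Koebe_nth_nonneg Koebe_nth_0 that(1) norm_less_Koebe_conv_radius[OF r1] this]
    show ?thesis unfolding eval_fps_Koebe[OF r1] .
  qed
  show "eval_fps (f oo Koebe) x = eval_fps f (4 * x / (1 - x)\<^sup>2)"
    using s[OF x] by (simp add: eval_fps_def sums_iff)
  \<comment> \<open>Convergence at every nonnegative \<open>r\<close> below the root gives the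
    radius, which is needed later to evaluate products containing the composition.\<close>
  have "fps_conv_radius (f oo Koebe) \<ge> ereal (3 - 2 * sqrt 2)"
    unfolding fps_conv_radius_def
    by (rule conv_radius_geI_ex') (auto intro!: sums_summable[OF s])
  moreover have "ereal (norm x) < ereal (3 - 2 * sqrt 2)" using x by simp
  ultimately show "norm x < fps_conv_radius (f oo Koebe)" by (meson less_le_trans)
qed

lemma eval_geo_gauss_compose:
  assumes a: "-2 \<le> a" "a \<le> 0" and x: "0 \<le> x" "x < 3 - 2 * sqrt 2"
  defines "u \<equiv> 4 * x / (1 - x)\<^sup>2"
  shows "eval_fps (geo ^ k * gauss_fps a oo Koebe) x = (1 / (1 - u)) ^ k * eval_fps (gauss_fps a) u"
    and "norm x < fps_conv_radius (geo ^ k * gauss_fps a oo Koebe)"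
proof -
  note k = Koebe_range[OF x]
  have nn: "fps_nth (geo ^ k * gauss_fps a) n \<ge> 0" for n
    by (intro fps_mult_nth_nonneg geo_power_nth_nonneg gauss_fps_nth_nonneg)
  have r: "1 \<le> fps_conv_radius (geo ^ k * gauss_fps a)"
    using fps_conv_radius_mult[of "geo ^ k" "gauss_fps a"] gauss_fps_conv_radius[OF a]
      geo_conv_radius fps_conv_radius_power[of geo k] by (metis min.bounded_iff order_trans)
  have u: "\<bar>u\<bar> < 1" unfolding u_def abs_of_nonneg[OF k(2)] by (rule k(3))
  show "eval_fps (geo ^ k * gauss_fps a oo Koebe) x = (1 / (1 - u)) ^ k * eval_fps (gauss_fps a) u"
    unfolding compose_Koebe_eval(1)[OF nn r x] u_def[symmetric]
    by (subst eval_fps_mult) (use u in \<open>auto intro!: norm_less_geo_conv_radius norm_less_gauss_fps_conv_radius a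
      simp: eval_fps_geo_power simp del: real_norm_def\<close>)
  show "norm x < fps_conv_radius (geo ^ k * gauss_fps a oo Koebe)"
    by (rule compose_Koebe_eval(2)[OF nn r x])
qed

lemma eval_A_bar:
  assumes x: "0 \<le> x" "x < 3 - 2 * sqrt 2"
  defines "u \<equiv> 4 * x / (1 - x)\<^sup>2"
  shows "eval_fps A_bar x = 4 * (1 + x) * (1 / (1 - x)) ^ 3 * (1 / (1 - u))\<^sup>2 * eval_fps (gauss_fps (-1/2)) u"
proof -
  have x1: "\<bar>x\<bar> < 1" using Koebe_range[OF x] x by simp
  have a: "(-2::real) \<le> -1/2" "(-1/2::real) \<le> 0" by simp_all
  note r = norm_less_geo_conv_radius[OF x1, of 3] eval_geo_gauss_compose(2)[OF a x, of 2]
  show ?thesis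
    unfolding A_bar_eq u_def using r
    by (simp add: eval_fps_mult eval_fps_add norm_less_fps_conv_radius eval_fps_geo_power[OF x1]
        eval_geo_gauss_compose(1)[OF a x, of 2, simplified] del: real_norm_def)
qed

lemma eval_V_bar:
  assumes x: "0 \<le> x" "x < 3 - 2 * sqrt 2"
  defines "u \<equiv> 4 * x / (1 - x)\<^sup>2"
  shows "eval_fps V_bar x = 2 * (1 / (1 - x)) ^ 3 * (1 / (1 - u)) ^ 3 * eval_fps (gauss_fps (-3/2)) u"
proof -
  have x1: "\<bar>x\<bar> < 1" using Koebe_range[OF x] x by simp
  have a: "(-2::real) \<le> -3/2" "(-3/2::real) \<le> 0" by simp_all
  note r = norm_less_geo_conv_radius[OF x1, of 3] eval_geo_gauss_compose(2)[OF a x, of 3]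
  show ?thesis
    unfolding V_bar_eq u_def using r
    by (simp add: eval_fps_mult norm_less_fps_conv_radius eval_fps_geo_power[OF x1]
        eval_geo_gauss_compose(1)[OF a x, of 3, simplified] del: real_norm_def)
qed

section \<open>The isoperimetric ratio\<close>

definition param :: "real \<Rightarrow> real" where "param z = 4 * z\<^sup>2 / (1 - z\<^sup>2)\<^sup>2"

text \<open>The logarithm of the value of \<open>Iso\<close> at 0, since \<open>log_ratio\<close>
  vanishes there.\<close>

definition iso_const :: real where "iso_const = ln (3/2) - 1/4 * ln (2 * pi\<^sup>2)"

lemma square_bound:
  assumes "0 \<le> z" "z < sqrt 2 - 1"
  shows "0 \<le> z\<^sup>2" "z\<^sup>2 < 3 - 2 * sqrt 2"
proof -
  have "z\<^sup>2 < (sqrt 2 - 1)\<^sup>2" using assms by (intro power_strict_mono) auto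
  also have "(sqrt 2 - 1)\<^sup>2 = 3 - 2 * sqrt 2" by (simp add: power2_diff)
  finally show "z\<^sup>2 < 3 - 2 * sqrt 2" .
qed simp

text \<open>The factor \<open>s\<close> enters \<open>A_fun\<close> squared and \<open>V_fun\<close>
  cubed, so it cancels in the ratio. The remaining factor \<open>(1 + w) / (1 - w)\<close> of
  \<open>A_fun\<close> is the square root of \<open>1 + u\<close>, whence the exponent
  \<open>3/4\<close> in \<open>log_ratio\<close>.\<close>

lemma Iso_eq:
  assumes z: "0 \<le> z" "z < sqrt 2 - 1"
  shows "Iso z = exp (iso_const + log_ratio (param z))"
proof -
  define w u where "w = z\<^sup>2" and "u = param z"
  define f g s k where "f = eval_fps (gauss_fps (-1/2)) u" and "g = eval_fps (gauss_fps (-3/2)) u"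
    and "s = 1 / ((1 - w) * (1 - u))" and "k = sqrt 2 * pi\<^sup>2"
  note w = square_bound[OF z, folded w_def]
  have u_eq: "u = 4 * w / (1 - w)\<^sup>2" by (simp add: u_def w_def param_def)
  have r: "w < 1" "0 \<le> u" "u < 1" using Koebe_range[OF w] by (simp_all add: u_eq)
  have f: "f > 0" and g: "g > 0"
    unfolding f_def g_def using r by (auto intro!: eval_gauss_fps_pos)
  have s: "s > 0" and k: "k > 0" using r by (simp_all add: s_def k_def)
  have u1: "1 + u = ((1 + w) / (1 - w))\<^sup>2"
    using r by (simp add: u_eq power_divide divide_simps) (simp add: power2_eq_square algebra_simps)
  have A: "A_fun z = k * (4 * ((1 + w) / (1 - w)) * s\<^sup>2 * f)"
    unfolding A_fun_def w_def[symmetric] eval_A_bar[OF w] u_eq[symmetric] f_def k_def s_def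
    by (simp add: power_divide power_mult_distrib power2_eq_square power3_eq_cube)
  have V: "V_fun z = k * (2 * s ^ 3 * g)"
    unfolding V_fun_def w_def[symmetric] eval_V_bar[OF w] u_eq[symmetric] g_def k_def s_def
    by (simp add: power_divide power_mult_distrib)
  define m where "m = (1 + w) / (1 - w)"
  have m: "m > 0" using r w by (simp add: m_def)
  have ln_A: "ln (A_fun z) = ln k + 2 * ln 2 + ln (1 + u) / 2 + 2 * ln s + ln f"
    unfolding A u1 m_def[symmetric] using m f s k ln_realpow[of 2 2]
    by (simp add: ln_mult ln_realpow)
  have ln_V: "ln (V_fun z) = ln k + ln 2 + 3 * ln s + ln g"
    unfolding V using g s k by (simp add: ln_mult ln_realpow)
  have pos: "A_fun z > 0" "V_fun z > 0"
    unfolding A V m_def[symmetric] using m f g s k by simp_all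
  have ln_k: "ln k = ln 2 / 2 + 2 * ln pi"
    unfolding k_def by (simp add: ln_mult ln_sqrt ln_realpow)
  have "Iso z > 0" using pos by (simp add: Iso_def)
  moreover have "ln (Iso z) = ln 6 + ln pi / 2 + ln (V_fun z) - 3/2 * ln (A_fun z)"
    using pos unfolding Iso_def by (simp add: ln_mult ln_div ln_sqrt ln_powr)
  moreover have "\<dots> = iso_const + log_ratio u"
    unfolding ln_A ln_V ln_k log_ratio_def iso_const_def f_def[symmetric] g_def[symmetric]
    using ln_mult[of 2 "3::real"] by (simp add: ln_mult ln_div ln_realpow field_simps)
  ultimately show ?thesis unfolding u_def by (metis exp_ln)
qed

lemma param_strict_mono:
  assumes "0 \<le> x" "x < y" "y \<le> sqrt 2 - 1"
  shows "param x < param y"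
proof -
  have "sqrt 2 < (2::real)" by (simp add: real_less_lsqrt)
  then have y: "y < 1" using assms by linarith
  have xy: "x\<^sup>2 < y\<^sup>2" using assms by (intro power_strict_mono) auto
  have y2: "y\<^sup>2 < 1" using assms y by (simp add: power_less_one_iff)
  have "(1 - y\<^sup>2)\<^sup>2 < (1 - x\<^sup>2)\<^sup>2" using xy y2 by (intro power_strict_mono) auto
  then show ?thesis
    unfolding param_def using xy y2 by (intro frac_less) auto
qed

text \<open>The square of \<open>sqrt 2 - 1\<close> is a root of \<open>w^2 - 6 * w + 1\<close>,
  that is, of \<open>(1 - w)^2 = 4 * w\<close>.\<close>

lemma param_end: "param (sqrt 2 - 1) = 1"
proof -
  have sq: "(sqrt 2 - 1)\<^sup>2 = 3 - 2 * sqrt 2" by (simp add: power2_diff)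
  have "(1 - (3 - 2 * sqrt 2))\<^sup>2 = 4 * (3 - 2 * sqrt (2::real))"
    by (simp add: power2_eq_square algebra_simps)
  moreover have "3 - 2 * sqrt 2 = (sqrt 2 - (1::real))\<^sup>2" by (simp add: sq)
  then have "3 - 2 * sqrt 2 \<noteq> (0::real)" by simp
  ultimately show ?thesis unfolding param_def sq by simp
qed

theorem theorem3:
  shows "strict_mono_on {0..<sqrt 2 - 1} Iso
    \<and> (Iso \<longlongrightarrow> 1) (at_left (sqrt 2 - 1))
    \<and> bij_betw Iso {0..<sqrt 2 - 1} {3/2 * (2 * pi^2) powr (-1/4)..<1}"
proof -
  define b :: real where "b = sqrt 2 - 1"
  \<comment> \<open>\<open>J\<close> agrees with \<open>Iso\<close> on the half-open interval and is
    continuous up to \<open>b\<close>, where \<open>param\<close> takes the value 1. Limit and range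
    are therefore read off from \<open>J\<close> on a compact interval.\<close>
  define J where "J z = exp (iso_const + log_ratio (param z))" for z
  have b: "0 < b" "b < 1" by (simp_all add: b_def real_less_lsqrt)
  have eq: "Iso z = J z" if "z \<in> {0..<b}" for z
    using Iso_eq[of z] that by (simp add: J_def b_def)
  have range: "0 \<le> param z" "param z \<le> 1" if "z \<in> {0..b}" for z
    using param_strict_mono[of z b] that param_end by (auto simp: b_def param_def le_less)
  have mono: "J x < J y" if "0 \<le> x" "x < y" "y \<le> b" for x y
    using log_ratio_strict_mono[OF range(1)[of x] param_strict_mono[of x y] range(2)[of y]] that
    by (simp add: J_def b_def)
  have "z\<^sup>2 \<noteq> 1" if "z \<in> {0..b}" for z
    using that b by (simp add: power2_eq_1_iff)
  then have "continuous_on {0..b} param"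
    unfolding param_def by (intro continuous_intros) auto
  then have cont: "continuous_on {0..b} J"
    unfolding J_def
    by (intro continuous_intros continuous_on_compose2[OF continuous_on_log_ratio]) (use range in auto)
  have J0: "J 0 = 3/2 * (2 * pi^2) powr (-1/4)"
  proof -
    have "J 0 = exp (ln (3/2) + (-1/4) * ln (2 * pi\<^sup>2))"
      by (simp add: J_def iso_const_def param_def log_ratio_0)
    also have "\<dots> = 3/2 * (2 * pi^2) powr (-1/4)"
      unfolding exp_add by (simp add: powr_def)
    finally show ?thesis .
  qed
  \<comment> \<open>Here the two Gauss values combine: all logarithms of 2, 3 and \<open>pi\<close>
    cancel.\<close>
  have "iso_const + log_ratio 1 = 0"
    unfolding iso_const_def log_ratio_1 by (simp add: ln_div ln_mult ln_realpow field_simps)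
  then have J1: "J b = 1"
    using param_end by (simp add: J_def b_def)
  have "strict_mono_on {0..<b} Iso"
    by (rule strict_mono_onI) (use mono eq in auto)
  moreover have "(Iso \<longlongrightarrow> 1) (at_left b)"
  proof -
    have "(J \<longlongrightarrow> J b) (at b within {0..b})"
      using cont b by (auto simp: continuous_on_def)
    then have "(J \<longlongrightarrow> 1) (at_left b)"
      using b at_within_Icc_at_left[of 0 b] by (simp add: J1)
    moreover have "\<forall>\<^sub>F z in at_left b. J z = Iso z"
      using eventually_at_left_real[OF b(1)] by (rule eventually_mono) (use eq in auto)
    ultimately show ?thesis by (rule Lim_transform_eventually)
  qed
  moreover have "bij_betw Iso {0..<b} {J 0..<1}"
  proof (rule bij_betw_imageI)
    show "inj_on Iso {0..<b}"
      by (rule strict_mono_on_imp_inj_on) fact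
    show "Iso ` {0..<b} = {J 0..<1}"
    proof (intro equalityI subsetI)
      fix y assume "y \<in> Iso ` {0..<b}"
      then obtain z where z: "z \<in> {0..<b}" "y = J z" using eq by auto
      then show "y \<in> {J 0..<1}"
        using mono[of 0 z] mono[of z b] J1 by (cases "z = 0") auto
    next
      fix y assume y: "y \<in> {J 0..<1}"
      \<comment> \<open>The intermediate value theorem is applied on the closed interval; the end
        point \<open>b\<close> is then ruled out because \<open>y < 1 = J b\<close>.\<close>
      then obtain z where z: "0 \<le> z" "z \<le> b" "J z = y"
        using IVT'[of J 0 y b] cont b J1 by auto
      moreover have "z \<noteq> b" using z y J1 by auto
      ultimately show "y \<in> Iso ` {0..<b}"
        using eq[of z] by (intro image_eqI[of _ _ z]) auto
    qed
  qed
  ultimately show ?thesis unfolding b_def J0 by blast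
qed

end
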